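(* Let $n\ge 4$ be an integer. Among all connected unicyclic signed graphs on $n$ vertices: if $n\in\{5,7\}$, the cycle $C_n^+$ has maximal energy, i.e. $E(\Gamma)\le E(C_n^+)$ for every connected unicyclic signed graph $\Gamma$ on $n$ vertices; for all other values $n\ge 4$ (that is, $n=4$, $n=6$ and $n\ge 8$), the signed graph $\mathcal{P}_n^4$ has maximal energy, i.e. $E(\Gamma)\le E(\mathcal{P}_n^4)$ for every connected unicyclic signed graph $\Gamma$ on $n$ vertices.
   Context: All graphs are finite and simple. A signed graph $\Gamma=(G,\sigma)$ is a graph $G$ together with a sign function $\sigma:E(G)\to\{+,-\}$ (identified with $\{+1,-1\}$). Its adjacency matrix $A(\Gamma)=(a_{ij})$ has $a_{ij}=\sigma(v_iv_j)$ if $v_iv_j\in E(G)$ and $0$ otherwise. The eigenvalues $x_1,\dots,x_n$ of $\Gamma$ are those of $A(\Gamma)$, and the energy is $E(\Gamma)=\sum_{j=1}^n|x_j|$. A connected unicyclic signed graph is one whose underlying graph is connected and contains exactly one cycle. The sign of a cycle is the product of the signs of its edges; the cycle is positive or negative according to this sign. $C_n^+$ denotes the cycle on $n$ vertices with positive sign (e.g. all edges positive). For $n\ge 4$, $\mathcal{P}_n^4$ denotes the unicyclic signed graph of order $n$ obtained by joining, by an edge, a vertex of the negative 4-cycle (exactly one negative edge) to a terminal vertex of the path $P_{n-4}$ on $n-4$ vertices, all edges outside the cycle being positive; for $n=4$ it is the negative 4-cycle itself. (Changing the signature while keeping the sign of the cycle does not change the spectrum.) *)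

theory Defs
  imports Complex_Main "Jordan_Normal_Form.Char_Poly" "Graph_Theory.Graph_Theory"
begin

text \<open>
  A finite simple graph is a \<open>pair_graph\<close>: a finite, loop-free, symmetric digraph in which the
  undirected edge \<open>{u, v}\<close> is represented by the two arcs \<open>(u, v)\<close> and \<open>(v, u)\<close>.
  The sign function takes the undirected edge as its argument, so its symmetry is automatic; its
  values on sets that are not edges are irrelevant.
\<close>

locale signed_graph = pair_graph G for G :: "'a pair_pre_digraph" +
  fixes \<sigma> :: "'a set \<Rightarrow> int"
  assumes sign_values: "(u, v) \<in> parcs G \<Longrightarrow> \<sigma> {u, v} \<in> {1, -1}"

text \<open>
  In a symmetric digraph the closed walk \<open>u, v, u\<close> along a single undirected edge counts as a
  cycle of the digraph; requiring length at least 3 excludes exactly these.  A cycle as a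
  subgraph is identified by its set of undirected edges, so that the different starting points
  and the two directions of traversal of a cycle count once.
\<close>

definition cycle_edge_set :: "'a pair_pre_digraph \<Rightarrow> 'a set set \<Rightarrow> bool" where
  "cycle_edge_set G C \<longleftrightarrow>
     (\<exists>p. pre_digraph.cycle (with_proj G) p \<and> length p \<ge> 3 \<and> C = (\<lambda>(u, v). {u, v}) ` set p)"

definition connected_unicyclic :: "'a pair_pre_digraph \<Rightarrow> bool" where
  "connected_unicyclic G \<longleftrightarrow>
     Digraph_Component.connected (with_proj G) \<and> (\<exists>!C. cycle_edge_set G C)"

definition signed_adj_mat :: "'a list \<Rightarrow> 'a pair_pre_digraph \<Rightarrow> ('a set \<Rightarrow> int) \<Rightarrow> complex mat" where
  "signed_adj_mat vs G \<sigma> = mat (length vs) (length vs)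
     (\<lambda>(i, j). if (vs ! i, vs ! j) \<in> parcs G then of_int (\<sigma> {vs ! i, vs ! j}) else 0)"

text \<open>
  The eigenvalues, with algebraic multiplicity, are the complex roots of the characteristic
  polynomial; there are as many of them as vertices.  The vertices are listed in an arbitrary
  order, which by \<open>energy_eqI\<close> below does not matter.
\<close>

definition eigenvalues :: "complex mat \<Rightarrow> complex multiset" where
  "eigenvalues A = proots (char_poly A)"

definition energy :: "'a pair_pre_digraph \<Rightarrow> ('a set \<Rightarrow> int) \<Rightarrow> real" where
  "energy G \<sigma> =
     (let vs = (SOME vs. distinct vs \<and> set vs = pverts G)
      in \<Sum>x\<in>#eigenvalues (signed_adj_mat vs G \<sigma>). cmod x)"

lemma char_poly_signed_adj_mat_reorder:
  assumes "distinct vs" "distinct ws" "set vs = set ws"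
  shows "char_poly (signed_adj_mat vs G \<sigma>) = char_poly (signed_adj_mat ws G \<sigma>)"
proof -
  define n where "n = length ws"
  have n: "length vs = n" "length ws = n"
    using assms by (metis distinct_card n_def)+
  have "mset vs = mset ws"
    using assms by (simp add: set_eq_iff_mset_eq_distinct)
  then obtain p where p: "p permutes {..<length ws}" "permute_list p ws = vs"
    by (metis mset_eq_permutation)
  have perm: "p permutes {0..<n}"
    using p(1) n by (simp add: atLeast0LessThan)
  have nth: "vs ! i = ws ! p i" if "i < n" for i
    using permute_list_nth[OF p(1), of i] that p(2) n by simp
  have lt: "p i < n" if "i < n" for i
    using permutes_in_image[OF perm, of i] that by simp
  have inj: "p i = p j \<longleftrightarrow> i = j" for i j
    using permutes_inj[OF perm] by (auto dest: injD)
  let ?B = "char_poly_matrix (signed_adj_mat ws G \<sigma>)"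
  define R where "R = mat n n (\<lambda>(i, j). ?B $$ (p i, j))"
  have B: "?B \<in> carrier_mat n n"
    by (simp add: char_poly_matrix_def signed_adj_mat_def n)
  have R: "R \<in> carrier_mat n n" by (simp add: R_def)
  have sq: "signof p * signof p = (1 :: complex poly)"
    by (simp add: sign_def)
  have "char_poly_matrix (signed_adj_mat vs G \<sigma>) =
      transpose_mat (mat n n (\<lambda>(i, j). transpose_mat R $$ (p i, j)))"
    by (rule eq_matI)
       (auto simp: char_poly_matrix_def signed_adj_mat_def n R_def nth lt inj)
  then have "det (char_poly_matrix (signed_adj_mat vs G \<sigma>)) =
      det (mat n n (\<lambda>(i, j). transpose_mat R $$ (p i, j)))"
    by (simp add: det_transpose[where n = n])
  also have "\<dots> = signof p * det (transpose_mat R)"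
    by (rule det_permute_rows[OF _ perm]) (use R in simp)
  also have "\<dots> = signof p * det R"
    using det_transpose[OF R] by simp
  also have "det R = signof p * det ?B"
    unfolding R_def by (rule det_permute_rows[OF B perm])
  finally show ?thesis
    using sq by (simp add: char_poly_def mult.assoc[symmetric])
qed

lemma energy_eqI:
  assumes "distinct vs" "set vs = pverts G"
  shows "energy G \<sigma> = (\<Sum>x\<in>#eigenvalues (signed_adj_mat vs G \<sigma>). cmod x)"
proof -
  define ws where "ws = (SOME ws. distinct ws \<and> set ws = pverts G)"
  have "distinct ws \<and> set ws = pverts G"
    unfolding ws_def by (rule someI[of _ vs]) (use assms in simp)
  then have "char_poly (signed_adj_mat ws G \<sigma>) = char_poly (signed_adj_mat vs G \<sigma>)"
    using assms by (intro char_poly_signed_adj_mat_reorder) auto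
  then show ?thesis
    by (simp add: energy_def eigenvalues_def ws_def Let_def)
qed

definition cycle_graph :: "nat \<Rightarrow> nat pair_pre_digraph" where
  "cycle_graph n = \<lparr>pverts = {..<n},
     parcs = {(i, j). i < n \<and> j < n \<and> (j = Suc i mod n \<or> i = Suc j mod n)}\<rparr>"

definition cycle_pos_sign :: "nat set \<Rightarrow> int" where
  "cycle_pos_sign e = 1"

text \<open>
  \<open>P4_graph n\<close> (for \<open>n \<ge> 4\<close>): the 4-cycle on \<open>0, 1, 2, 3\<close>, whose vertex \<open>3\<close> is joined to the
  end vertex \<open>4\<close> of the path \<open>4, \<dots>, n - 1\<close> (no path if \<open>n = 4\<close>).  The only negative edge is
  \<open>{0, 3}\<close>.
\<close>

definition P4_graph :: "nat \<Rightarrow> nat pair_pre_digraph" where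
  "P4_graph n = \<lparr>pverts = {..<n},
     parcs = {(i, j). i < n \<and> j < n \<and> (j = Suc i \<or> i = Suc j)} \<union> {(0, 3), (3, 0)}\<rparr>"

definition P4_sign :: "nat set \<Rightarrow> int" where
  "P4_sign e = (if e = {0, 3} then -1 else 1)"

lemma signed_graph_cycle_graph: "n \<ge> 3 \<Longrightarrow> signed_graph (cycle_graph n) cycle_pos_sign"
  by unfold_locales
     (auto simp: cycle_graph_def cycle_pos_sign_def Digraph.symmetric_def sym_def mod_Suc
           split: if_splits intro: finite_subset[of _ "{..<n} \<times> {..<n}"])

lemma signed_graph_P4_graph: "n \<ge> 4 \<Longrightarrow> signed_graph (P4_graph n) P4_sign"
  by unfold_locales
     (auto simp: P4_graph_def P4_sign_def Digraph.symmetric_def sym_def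
           intro: finite_subset[of _ "{..<n} \<times> {..<n}"])

end

theory Submission
  imports Defs
begin

text \<open>
  For a signed graph with adjacency matrix \<open>A\<close> and eigenvalues \<open>\<lambda>\<close>, the function
  \<open>\<bar>det (I + \<i>xA)\<bar>\<^sup>2\<close> of \<open>x > 0\<close> equals \<open>\<Prod>(1 + \<lambda>\<^sup>2x\<^sup>2)\<close>.  The energy \<open>\<Sum>\<bar>\<lambda>\<bar>\<close> is a monotone
  functional of this product: this is Coulson's integral formula, of which only the monotonicity is
  used (\<open>sum_abs_le_if_prod_le\<close>).  So inequalities between such products, valid for all \<open>x > 0\<close>,
  turn into inequalities between energies, and both sides may first be multiplied by auxiliary
  factors \<open>1 + b\<^sup>2x\<^sup>2\<close> with known \<open>b\<close> (\<open>energy_le_if_char_sq_le\<close>).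

  Put \<open>t = x\<^sup>2\<close>.  Deleting a vertex of degree at most one reduces the determinant to smaller
  determinants with nonnegative weights, and every graph with a single cycle can be reduced in this
  way until only the cycle is left.  If the cycle has \<open>l\<close> vertices and \<open>m\<close> vertices lie outside it,
  the determinant is \<open>a + c(\<i>x)\<^sup>lb\<close> with \<open>c = 2\<close> or \<open>c = -2\<close>, where \<open>a\<close> is at most the matching
  polynomial of the tadpole (a cycle with a pendant path) and \<open>b\<close> at most that of the path on \<open>m\<close>
  vertices (\<open>det_only_cycle\<close>).  Hence the modulus is at most \<open>a + 2t\<^bsup>l/2\<^esup>b\<close> for even \<open>l\<close>, and its
  square is \<open>a\<^sup>2 + 4t\<^sup>lb\<^sup>2\<close> for odd \<open>l\<close>.  For the negative 4-cycle with a path attached all these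
  bounds are attained.

  What remains concerns polynomials in \<open>t\<close>.  For even \<open>l\<close>, and for odd \<open>l\<close> when \<open>n\<close> is even, the
  4-cycle tadpole dominates for every \<open>t\<close> (\<open>even_tadpole_le\<close>, \<open>odd_majorant_le_even_order\<close>).  When
  \<open>n\<close> and \<open>l\<close> are odd this fails for large \<open>t\<close>: the adjacency matrix of the 4-cycle tadpole is
  singular, while that of the odd cycle is not.  The quotient of the two sides, however, depends
  only on \<open>t\<close> and on the ratio of two consecutive path polynomials, and it is monotone in that
  ratio; for every odd \<open>n \<ge> 9\<close> it is therefore at most its value for \<open>n = 9\<close>
  (\<open>odd_majorant_ratio_le\<close>, \<open>odd_cycle_ratio_le\<close>).  For \<open>n = 9\<close> explicit rational factors decide
  the comparison.  For \<open>n = 5\<close> and \<open>n = 7\<close> the odd cycle dominates all graphs with an odd cycle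
  for every \<open>t\<close>, and its energy exceeds that of the 4-cycle tadpole by a margin that rational
  approximations of the eigenvalues confirm.
\<close>

section \<open>Matching polynomials of paths and tadpoles\<close>

text \<open>
  The matching polynomial \<open>\<Sum>m\<^sub>kt\<^sup>k\<close> of the path on \<open>n\<close> vertices, where \<open>m\<^sub>k\<close> counts the matchings
  with \<open>k\<close> edges.
\<close>

fun path_poly :: "nat \<Rightarrow> real \<Rightarrow> real" where
  "path_poly 0 t = 1"
| "path_poly (Suc 0) t = 1"
| "path_poly (Suc (Suc n)) t = path_poly (Suc n) t + t * path_poly n t"

lemma path_poly_values:
  "path_poly 1 t = 1"
  "path_poly 2 t = 1 + t"
  "path_poly 3 t = 1 + 2 * t"
  "path_poly 4 t = 1 + 3 * t + t\<^sup>2"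
  "path_poly 5 t = 1 + 4 * t + 3 * t\<^sup>2"
  "path_poly 6 t = 1 + 5 * t + 6 * t\<^sup>2 + t ^ 3"
  "path_poly 7 t = 1 + 6 * t + 10 * t\<^sup>2 + 4 * t ^ 3"
  "path_poly 8 t = 1 + 7 * t + 15 * t\<^sup>2 + 10 * t ^ 3 + t ^ 4"
  by (simp_all add: numeral_eq_Suc algebra_simps)

lemma path_poly_ge_1: "t \<ge> 0 \<Longrightarrow> path_poly n t \<ge> 1"
  by (induction n t rule: path_poly.induct) (auto intro: add_increasing2)

lemma path_poly_nonneg: "t \<ge> 0 \<Longrightarrow> path_poly n t \<ge> 0"
  using path_poly_ge_1[of t n] by linarith

lemma path_poly_Suc_mono: "t \<ge> 0 \<Longrightarrow> path_poly n t \<le> path_poly (Suc n) t"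
  by (cases n) (auto simp: path_poly_nonneg)

text \<open>
  Matchings of a path either use a given edge or avoid it.
\<close>

lemma path_poly_add:
  "path_poly (Suc (Suc (a + b))) t
     = path_poly (Suc a) t * path_poly (Suc b) t + t * path_poly a t * path_poly b t"
  by (induction a t rule: path_poly.induct) (auto simp: algebra_simps)

text \<open>
  Identifying an end of one path with an end of another one loses matchings.
\<close>

lemma path_poly_add_le:
  assumes "t \<ge> 0"
  shows "path_poly (a + b) t \<le> path_poly (Suc a) t * path_poly b t"
proof (cases a)
  case (Suc c)
  show ?thesis
  proof (cases b)
    case 0
    then show ?thesis using path_poly_Suc_mono[OF assms, of a] by simp
  next
    case b: (Suc d)
    have "t * path_poly c t * path_poly d t \<le> t * path_poly c t * path_poly b t"
      unfolding b using assms path_poly_Suc_mono[OF assms, of d] path_poly_nonneg[OF assms, of c]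
      by (intro mult_left_mono mult_nonneg_nonneg) auto
    then show ?thesis
      using path_poly_add[of c d t] by (simp add: Suc b algebra_simps)
  qed
qed simp

text \<open>
  The factor \<open>t\<^sup>k\<close> stands for a perfect matching of \<open>2k\<close> further vertices of the path.
\<close>

lemma power_mult_path_poly_le:
  assumes "t \<ge> 0"
  shows "t ^ k * path_poly m t \<le> path_poly (m + 2 * k) t"
proof (induction k)
  case (Suc k)
  have "t ^ Suc k * path_poly m t \<le> t * path_poly (m + 2 * k) t"
    using mult_left_mono[OF Suc assms] by (simp add: algebra_simps)
  also have "\<dots> \<le> path_poly (Suc (Suc (m + 2 * k))) t"
    using path_poly_nonneg[OF assms] by simp
  finally show ?case by simp
qed simp

text \<open>
  Cassini's identity, known for the Fibonacci numbers, which are the values at \<open>t = 1\<close>.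
\<close>

lemma path_poly_cassini:
  "(path_poly (Suc n) t)\<^sup>2 - path_poly n t * path_poly (Suc (Suc n)) t = (- t) ^ Suc n"
proof (induction n)
  case (Suc n)
  have "(path_poly (Suc (Suc n)) t)\<^sup>2 - path_poly (Suc n) t * path_poly (Suc (Suc (Suc n))) t
    = (- t) * ((path_poly (Suc n) t)\<^sup>2 - path_poly n t * path_poly (Suc (Suc n)) t)"
    by (simp add: algebra_simps power2_eq_square)
  then show ?case using Suc by simp
qed simp

text \<open>
  The ratios \<open>path_poly (Suc j) t / path_poly j t\<close> oscillate around their limit, and the ratio at
  \<open>j = 5\<close> is the largest from there on.  All comparisons of large odd orders with order 9 go back
  to this inequality.
\<close>

lemma path_poly_ratio_le:
  assumes "t \<ge> 0" "j \<ge> 5"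
  shows "path_poly (Suc j) t * path_poly 5 t \<le> path_poly j t * path_poly 6 t"
proof -
  obtain m where m: "j = m + 5" using assms(2) le_Suc_ex by (metis add.commute)
  have "path_poly j t * path_poly 6 t - path_poly (Suc j) t * path_poly 5 t
      = t ^ 5 * (path_poly (Suc m) t - path_poly m t)"
    unfolding m by (simp add: numeral_eq_Suc algebra_simps)
  also have "\<dots> \<ge> 0" using assms path_poly_Suc_mono[of t m] by simp
  finally show ?thesis by simp
qed

text \<open>
  The matching polynomial of a cycle on \<open>l\<close> vertices with a path on \<open>m\<close> vertices attached to it: the
  second summand counts the matchings that contain one fixed cycle edge at the vertex of attachment.
\<close>

definition tadpole_poly :: "nat \<Rightarrow> nat \<Rightarrow> real \<Rightarrow> real" where
  "tadpole_poly l m t = path_poly (l + m) t + t * path_poly (l - 2) t * path_poly m t"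

text \<open>
  The square root of \<open>char_sq\<close> for the graph \<open>P4_graph (4 + j)\<close>, see \<open>char_sq_P4\<close> below.
\<close>

definition P4_poly :: "nat \<Rightarrow> real \<Rightarrow> real" where
  "P4_poly j t = (1 + 2 * t) * (path_poly (Suc j) t + 2 * t * path_poly j t)"

text \<open>
  A common bound for all odd cycle lengths below the order \<open>4 + j\<close>.  It combines the largest
  tadpole polynomial, which belongs to \<open>l = 4\<close>, with the largest cycle term, which belongs to
  \<open>l = 3\<close>, and thus removes the cycle length from the comparison.
\<close>

definition odd_majorant :: "nat \<Rightarrow> real \<Rightarrow> real" where
  "odd_majorant j t = (tadpole_poly 4 j t)\<^sup>2 + 4 * t ^ 3 * (path_poly (Suc j) t)\<^sup>2"

lemma path_poly_shift4:
  "path_poly (4 + j) t = (1 + 2 * t) * path_poly (Suc j) t + (t + t\<^sup>2) * path_poly j t"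
  by (simp add: numeral_eq_Suc algebra_simps power2_eq_square)

lemma tadpole_poly_4:
  "tadpole_poly 4 j t = (1 + 2 * t) * path_poly (Suc j) t + (2 * t + 2 * t\<^sup>2) * path_poly j t"
proof -
  have "path_poly 2 t = 1 + t" by (simp add: numeral_eq_Suc)
  then show ?thesis
    unfolding tadpole_poly_def path_poly_shift4 by (simp add: algebra_simps power2_eq_square)
qed

lemma P4_poly_eq: "P4_poly j t = tadpole_poly 4 j t + 2 * t\<^sup>2 * path_poly j t"
  unfolding P4_poly_def tadpole_poly_4 by (simp add: algebra_simps power2_eq_square)

lemma tadpole_poly_ge_1: "t \<ge> 0 \<Longrightarrow> tadpole_poly l m t \<ge> 1"
  unfolding tadpole_poly_def
  using path_poly_ge_1[of t "l + m"] path_poly_nonneg[of t "l - 2"] path_poly_nonneg[of t m]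
  by (intro add_increasing2) auto

text \<open>
  Among the splittings of a path into two nonempty paths the one with a part of two vertices has
  the largest matching polynomial.
\<close>

lemma path_poly_mult_le:
  assumes t: "t \<ge> 0" and "a + b = j"
  shows "path_poly (Suc a) t * path_poly (Suc b) t \<le> path_poly 2 t * path_poly j t"
proof -
  have "path_poly (Suc j) t - path_poly j t \<le> t * path_poly a t * path_poly b t"
  proof (cases j)
    case 0
    then show ?thesis using t path_poly_nonneg[OF t] by simp
  next
    case (Suc i)
    have "path_poly i t \<le> path_poly a t * path_poly b t"
    proof (cases a)
      case 0
      then show ?thesis using assms Suc path_poly_Suc_mono[OF t, of i] by simp
    next
      case a: (Suc c)
      then have "i = c + b" using assms Suc by simp
      then show ?thesis using path_poly_add_le[OF t, of c b] a by simp
    qed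
    from mult_left_mono[OF this t] show ?thesis by (simp add: Suc algebra_simps)
  qed
  moreover have "path_poly 2 t = 1 + t" by (simp add: numeral_eq_Suc)
  ultimately show ?thesis
    using path_poly_add[of a b t] assms(2) by (simp add: algebra_simps)
qed

lemma tadpole_poly_le_4:
  assumes t: "t \<ge> 0" and "l \<ge> 3" "m \<ge> 1" "l + m = 4 + j"
  shows "tadpole_poly l m t \<le> tadpole_poly 4 j t"
proof -
  have "path_poly (l - 2) t * path_poly m t \<le> path_poly 2 t * path_poly j t"
    using path_poly_mult_le[OF t, of "l - 3" "m - 1" j] assms by (simp add: Suc_diff_Suc numeral_eq_Suc)
  from mult_left_mono[OF this t] show ?thesis
    unfolding tadpole_poly_def using assms by (simp add: mult.assoc)
qed

text \<open>
  As long as the cycle misses a vertex, both summands are largest for \<open>l = 4\<close>.  If it passes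
  through all vertices, \<open>tadpole_poly l 0\<close> may exceed \<open>tadpole_poly 4 j\<close>, and the cycle term of the
  4-cycle makes up for the difference.
\<close>

lemma even_tadpole_le:
  assumes t: "t \<ge> 0" and "even l" "l \<ge> 4" "l + m = 4 + j"
  shows "tadpole_poly l m t + 2 * t ^ (l div 2) * path_poly m t \<le> P4_poly j t"
proof (cases "m = 0")
  case False
  have k: "l = 4 + 2 * ((l - 4) div 2)" (is "l = 4 + 2 * ?k") using assms(2,3) by presburger
  have "t\<^sup>2 * (t ^ ?k * path_poly m t) \<le> t\<^sup>2 * path_poly j t"
  proof (rule mult_left_mono)
    have "m + 2 * ?k = j" using k assms(4) by linarith
    then show "t ^ ?k * path_poly m t \<le> path_poly j t"
      using power_mult_path_poly_le[OF t, of ?k m] by simp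
  qed simp
  moreover have "t ^ (l div 2) = t\<^sup>2 * t ^ ?k"
  proof -
    have "l div 2 = 2 + ?k" using k by presburger
    then show ?thesis by (simp only: power_add)
  qed
  ultimately show ?thesis
    using tadpole_poly_le_4[OF t, of l m j] assms False
    unfolding P4_poly_eq by (simp add: mult.assoc)
next
  case m: True
  then have l: "l = 4 + j" and "even j" using assms by auto
  then obtain k where k: "j = 2 * k" by auto
  have d: "l div 2 = 2 + k" using l k by simp
  show ?thesis
  proof (cases k)
    case 0
    then show ?thesis using k l m by (simp add: P4_poly_eq)
  next
    case (Suc i)
    then have j: "j = Suc (Suc (2 * i))" using k by simp
    have h: "t ^ i \<le> path_poly (2 * i) t" using power_mult_path_poly_le[OF t, of i 0] by simp
    have "P4_poly j t - (tadpole_poly l m t + 2 * t ^ (l div 2) * path_poly m t)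
       = t\<^sup>2 * path_poly (Suc (2 * i)) t + 2 * t ^ 3 * (path_poly (2 * i) t - t ^ i)"
      unfolding P4_poly_eq tadpole_poly_def d unfolding l m Suc
      by (simp add: j numeral_eq_Suc algebra_simps)
    moreover have "\<dots> \<ge> 0"
      using h t path_poly_nonneg[OF t] by (intro add_nonneg_nonneg mult_nonneg_nonneg) auto
    ultimately show ?thesis by linarith
  qed
qed

lemma odd_tadpole_le_majorant:
  assumes t: "t \<ge> 0" and "odd l" "l \<ge> 3" "m \<ge> 1" "l + m = 4 + j"
  shows "(tadpole_poly l m t)\<^sup>2 + 4 * t ^ l * (path_poly m t)\<^sup>2 \<le> odd_majorant j t"
proof -
  define c where "c = (l - 3) div 2"
  have c: "l = 3 + 2 * c" unfolding c_def using assms(2,3) by presburger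
  have "(t ^ c * path_poly m t)\<^sup>2 \<le> (path_poly (Suc j) t)\<^sup>2"
    using power_mult_path_poly_le[OF t, of c m] assms c t path_poly_nonneg[OF t, of m]
    by (intro power_mono) (auto simp: add.commute)
  then have "4 * t ^ 3 * (t ^ c * path_poly m t)\<^sup>2 \<le> 4 * t ^ 3 * (path_poly (Suc j) t)\<^sup>2"
    using t by (intro mult_left_mono) auto
  moreover have "t ^ l = t ^ 3 * (t ^ c)\<^sup>2"
    unfolding c by (simp only: power_add power_mult power_even_eq mult.commute[of 2])
  moreover have "(tadpole_poly l m t)\<^sup>2 \<le> (tadpole_poly 4 j t)\<^sup>2"
    using tadpole_poly_le_4[OF t, of l m j] assms tadpole_poly_ge_1[OF t, of l m]
    by (intro power_mono) auto
  ultimately show ?thesis unfolding odd_majorant_def by (simp add: power_mult_distrib mult.assoc)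
qed

text \<open>
  For even \<open>j\<close> Cassini's identity bounds the square of \<open>path_poly (Suc j)\<close> by the product of its
  neighbours, so the cycle term in \<open>odd_majorant\<close> is absorbed by the mixed term in the square of
  \<open>P4_poly j = tadpole_poly 4 j + 2t\<^sup>2 path_poly j\<close>.
\<close>

lemma odd_majorant_le_even_order:
  assumes t: "t \<ge> 0" and "even j"
  shows "odd_majorant j t \<le> (P4_poly j t)\<^sup>2"
proof -
  define p where "p = path_poly j t"
  define T where "T = tadpole_poly 4 j t"
  have p: "p \<ge> 0" unfolding p_def using path_poly_nonneg[OF t] by simp
  have T: "T \<ge> 0" unfolding T_def using tadpole_poly_ge_1[OF t, of 4 j] by linarith
  have "(path_poly (Suc j) t)\<^sup>2 \<le> p * path_poly (Suc (Suc j)) t"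
  proof -
    have "(- t) ^ Suc j \<le> 0" using assms by simp
    then show ?thesis using path_poly_cassini[of j t] unfolding p_def by linarith
  qed
  then have "t * (path_poly (Suc j) t)\<^sup>2 \<le> t * (p * path_poly (Suc (Suc j)) t)"
    using t by (rule mult_left_mono)
  also have "\<dots> = p * (t * path_poly (Suc (Suc j)) t)" by simp
  also have "\<dots> \<le> p * T"
  proof (rule mult_left_mono[OF _ p])
    have "t * path_poly (Suc (Suc j)) t \<le> path_poly (4 + j) t"
      using path_poly_nonneg[OF t, of "Suc (Suc (Suc j))"] by (simp add: numeral_eq_Suc)
    also have "\<dots> \<le> T" unfolding T_def tadpole_poly_def using t path_poly_nonneg[OF t] by simp
    finally show "t * path_poly (Suc (Suc j)) t \<le> T" .
  qed
  finally have "4 * t\<^sup>2 * (t * (path_poly (Suc j) t)\<^sup>2) \<le> 4 * t\<^sup>2 * (p * T)"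
    by (intro mult_left_mono) auto
  moreover have "(P4_poly j t)\<^sup>2 = T\<^sup>2 + 4 * t\<^sup>2 * (p * T) + (2 * t\<^sup>2 * p)\<^sup>2"
    unfolding P4_poly_eq p_def T_def by (simp add: algebra_simps power2_eq_square)
  moreover have "odd_majorant j t = T\<^sup>2 + 4 * t\<^sup>2 * (t * (path_poly (Suc j) t)\<^sup>2)"
    unfolding odd_majorant_def T_def by (simp add: power3_eq_cube power2_eq_square)
  moreover have "(2 * t\<^sup>2 * p)\<^sup>2 \<ge> 0" by simp
  ultimately show ?thesis by linarith
qed

text \<open>
  Divided by \<open>P4_poly j\<close>, both \<open>tadpole_poly 4 j\<close> and \<open>path_poly (Suc j)\<close> are increasing functions
  of \<open>path_poly (Suc j) / path_poly j\<close>, so \<open>path_poly_ratio_le\<close> applies to each of the two squares.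
\<close>

lemma odd_majorant_ratio_le:
  assumes t: "t \<ge> 0" and j: "j \<ge> 5"
  shows "odd_majorant j t * (P4_poly 5 t)\<^sup>2 \<le> (P4_poly j t)\<^sup>2 * odd_majorant 5 t"
proof -
  let ?p = "path_poly j t" and ?q = "path_poly (Suc j) t"
  let ?p5 = "path_poly 5 t" and ?q5 = "path_poly (Suc 5) t"
  have nn: "?p \<ge> 0" "?q \<ge> 0" "?p5 \<ge> 0" "?q5 \<ge> 0" using path_poly_nonneg[OF t] by auto
  have cr: "0 \<le> ?p * ?q5 - ?q * ?p5" using path_poly_ratio_le[OF t j] by simp
  have S0: "P4_poly i t \<ge> 0" for i
    unfolding P4_poly_def using t path_poly_nonneg[OF t] by simp
  have "P4_poly j t * tadpole_poly 4 5 t - tadpole_poly 4 j t * P4_poly 5 t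
     = 2 * t\<^sup>2 * (1 + 2 * t) * (?p * ?q5 - ?q * ?p5)"
    unfolding P4_poly_eq tadpole_poly_4 by (simp add: algebra_simps power2_eq_square)
  moreover have "\<dots> \<ge> 0" using cr t by simp
  ultimately have U: "tadpole_poly 4 j t * P4_poly 5 t \<le> P4_poly j t * tadpole_poly 4 5 t"
    by linarith
  have "P4_poly j t * ?q5 - ?q * P4_poly 5 t
     = 2 * t * (1 + 2 * t) * (?p * ?q5 - ?q * ?p5)"
    unfolding P4_poly_def by (simp add: algebra_simps)
  moreover have "\<dots> \<ge> 0" using cr t by simp
  ultimately have V: "?q * P4_poly 5 t \<le> P4_poly j t * ?q5"
    by linarith
  have U2: "(tadpole_poly 4 j t * P4_poly 5 t)\<^sup>2 \<le> (P4_poly j t * tadpole_poly 4 5 t)\<^sup>2"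
    using U S0 tadpole_poly_ge_1[OF t, of 4 j] by (intro power_mono) auto
  have "(?q * P4_poly 5 t)\<^sup>2 \<le> (P4_poly j t * ?q5)\<^sup>2"
    using V S0 nn by (intro power_mono) auto
  then have "4 * t ^ 3 * (?q * P4_poly 5 t)\<^sup>2 \<le> 4 * t ^ 3 * (P4_poly j t * ?q5)\<^sup>2"
    using t by (intro mult_left_mono) auto
  with U2 show ?thesis unfolding odd_majorant_def
    by (simp add: algebra_simps power_mult_distrib)
qed

text \<open>
  Writing \<open>u\<close> and \<open>v\<close> for the roots of \<open>y\<^sup>2 = y + t\<close>, the left side is
  \<open>(u\<^sup>l + v\<^sup>l)\<^sup>2 - 4(uv)\<^sup>l = (u\<^sup>l - v\<^sup>l)\<^sup>2\<close>, and \<open>u\<^sup>l - v\<^sup>l\<close> is \<open>u - v\<close> times the path polynomial.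
\<close>

lemma odd_cycle_poly:
  assumes "odd l" "l \<ge> 3"
  shows "(tadpole_poly l 0 t)\<^sup>2 + 4 * t ^ l = (1 + 4 * t) * (path_poly (l - 1) t)\<^sup>2"
proof -
  obtain i where l: "l = Suc (Suc i)" using assms(2) by (metis add_2_eq_Suc le_Suc_ex numeral_3_eq_3 add_Suc)
  have "(path_poly (Suc i) t)\<^sup>2 - path_poly i t * path_poly (Suc (Suc i)) t = t ^ Suc i"
    using path_poly_cassini[of i t] assms l by simp
  then have "4 * t ^ l = 4 * t * ((path_poly (Suc i) t)\<^sup>2 - path_poly i t * path_poly (Suc (Suc i)) t)"
    unfolding l by simp
  then show ?thesis unfolding tadpole_poly_def l by (simp add: algebra_simps power2_eq_square)
qed

lemma odd_cycle_ratio_le: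
  assumes t: "t \<ge> 0" and j: "j \<ge> 5"
  shows "path_poly (j + 3) t * P4_poly 5 t \<le> P4_poly j t * path_poly 8 t"
proof -
  let ?p = "path_poly j t" and ?q = "path_poly (Suc j) t"
  let ?p5 = "path_poly 5 t" and ?q5 = "path_poly (Suc 5) t"
  have cr: "0 \<le> ?p * ?q5 - ?q * ?p5" using path_poly_ratio_le[OF t j] by simp
  have e: "path_poly (i + 3) t = (1 + t) * path_poly (Suc i) t + t * path_poly i t" for i
    by (simp add: numeral_eq_Suc algebra_simps)
  have "P4_poly j t * path_poly (5 + 3) t - path_poly (j + 3) t * P4_poly 5 t
     = t * (1 + 2 * t) * (1 + 2 * t) * (?p * ?q5 - ?q * ?p5)"
    unfolding P4_poly_def e by (simp add: algebra_simps)
  moreover have "\<dots> \<ge> 0" using cr t by simp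
  ultimately show ?thesis by simp
qed

text \<open>
  The differences are polynomials in \<open>t\<close> with nonnegative coefficients.  This is special to small
  orders: for \<open>l = 3\<close> and large odd \<open>n\<close> the inequality fails for large \<open>t\<close>.
\<close>

lemma odd_tadpole_le_cycle_5_7:
  assumes t: "t \<ge> 0" and "odd l" "l \<ge> 3" "l + m = n" "n \<in> {5, 7}"
  shows "(tadpole_poly l m t)\<^sup>2 + 4 * t ^ l * (path_poly m t)\<^sup>2
            \<le> (1 + 4 * t) * (path_poly (n - 1) t)\<^sup>2"
proof -
  have "l \<le> 7" using assms by auto
  then have "l = 3 \<or> l = 5 \<or> l = 7" using assms(2,3) by presburger
  then consider "m = 0" | "l = 3" "m = 2" "n = 5" | "l = 3" "m = 4" "n = 7" | "l = 5" "m = 2" "n = 7"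
    using assms(4,5) by auto
  then show ?thesis
  proof cases
    case 1
    then show ?thesis using odd_cycle_poly[OF assms(2,3), of t] assms(4) by simp
  next
    case 2
    have tp: "tadpole_poly l m t = 1 + 5 * t + 4 * t\<^sup>2"
      by (simp add: 2 tadpole_poly_def path_poly_values) (simp add: algebra_simps numeral_eq_Suc)
    have "(1 + 4 * t) * (path_poly (n - 1) t)\<^sup>2 -
       ((tadpole_poly l m t)\<^sup>2 + 4 * t ^ l * (path_poly m t)\<^sup>2) = t\<^sup>2 * (2 + 6 * t + t\<^sup>2)"
      unfolding tp by (simp add: 2 path_poly_values) (simp add: algebra_simps numeral_eq_Suc)
    moreover have "\<dots> \<ge> 0" using t by simp
    ultimately show ?thesis by linarith
  next
    case 3
    have tp: "tadpole_poly l m t = 1 + 7 * t + 13 * t\<^sup>2 + 5 * t ^ 3"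
      by (simp add: 3 tadpole_poly_def path_poly_values) (simp add: algebra_simps numeral_eq_Suc)
    have "(1 + 4 * t) * (path_poly (n - 1) t)\<^sup>2 -
       ((tadpole_poly l m t)\<^sup>2 + 4 * t ^ l * (path_poly m t)\<^sup>2)
         = t\<^sup>2 * (2 + 14 * t + 31 * t\<^sup>2 + 22 * t ^ 3)"
      unfolding tp by (simp add: 3 path_poly_values) (simp add: algebra_simps numeral_eq_Suc)
    moreover have "\<dots> \<ge> 0" using t by simp
    ultimately show ?thesis by linarith
  next
    case 4
    have tp: "tadpole_poly l m t = 1 + 7 * t + 13 * t\<^sup>2 + 6 * t ^ 3"
      by (simp add: 4 tadpole_poly_def path_poly_values) (simp add: algebra_simps numeral_eq_Suc)
    have "(1 + 4 * t) * (path_poly (n - 1) t)\<^sup>2 -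
       ((tadpole_poly l m t)\<^sup>2 + 4 * t ^ l * (path_poly m t)\<^sup>2)
         = t\<^sup>2 * (2 + 16 * t + 41 * t\<^sup>2 + 36 * t ^ 3 + 5 * t ^ 4)"
      unfolding tp by (simp add: 4 path_poly_values) (simp add: algebra_simps numeral_eq_Suc)
    moreover have "\<dots> \<ge> 0" using t by simp
    ultimately show ?thesis by linarith
  qed
qed

section \<open>Comparing sums of absolute values through products\<close>

text \<open>
  An antiderivative of \<open>ln (1 + a\<^sup>2x\<^sup>2) / x\<^sup>2\<close>, obtained by partial integration.  It tends to \<open>0\<close> at \<open>0\<close>
  and to \<open>\<pi>\<bar>a\<bar>\<close> at infinity.
\<close>

definition log_primitive :: "real \<Rightarrow> real \<Rightarrow> real" where
  "log_primitive a x = 2 * \<bar>a\<bar> * arctan (\<bar>a\<bar> * x) - ln (1 + a\<^sup>2 * x\<^sup>2) / x"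

lemma log_primitive_deriv:
  assumes "x > 0"
  shows "(log_primitive a has_real_derivative ln (1 + a\<^sup>2 * x\<^sup>2) / x\<^sup>2) (at x)"
proof -
  have pos: "1 + a\<^sup>2 * x\<^sup>2 > 0" by (simp add: add_pos_nonneg)
  have "((\<lambda>x. 2 * \<bar>a\<bar> * arctan (\<bar>a\<bar> * x) - ln (1 + a\<^sup>2 * x\<^sup>2) / x) has_real_derivative
      2 * \<bar>a\<bar> * (\<bar>a\<bar> / (1 + (\<bar>a\<bar> * x)\<^sup>2))
      - ((a\<^sup>2 * (2 * x) / (1 + a\<^sup>2 * x\<^sup>2)) * x - ln (1 + a\<^sup>2 * x\<^sup>2) * 1) / (x * x)) (at x)"
  proof (intro DERIV_diff DERIV_divide)
    have "((\<lambda>x. arctan (\<bar>a\<bar> * x)) has_real_derivative inverse (1 + (\<bar>a\<bar> * x)\<^sup>2) * \<bar>a\<bar>) (at x)"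
      by (rule DERIV_chain2[OF DERIV_arctan]) (auto intro!: derivative_eq_intros)
    from DERIV_cmult[OF this, of "2 * \<bar>a\<bar>"]
    show "((\<lambda>x. 2 * \<bar>a\<bar> * arctan (\<bar>a\<bar> * x)) has_real_derivative
        2 * \<bar>a\<bar> * (\<bar>a\<bar> / (1 + (\<bar>a\<bar> * x)\<^sup>2))) (at x)"
      by (simp only: divide_inverse mult.commute mult.left_commute)
    have "((\<lambda>x. ln (1 + a\<^sup>2 * x\<^sup>2)) has_real_derivative
        inverse (1 + a\<^sup>2 * x\<^sup>2) * (a\<^sup>2 * (2 * x))) (at x)"
      by (rule DERIV_chain2[where f = ln and g = "\<lambda>x. 1 + a\<^sup>2 * x\<^sup>2", OF DERIV_ln[OF pos]]) (auto intro!: derivative_eq_intros)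
    then show "((\<lambda>x. ln (1 + a\<^sup>2 * x\<^sup>2)) has_real_derivative
        a\<^sup>2 * (2 * x) / (1 + a\<^sup>2 * x\<^sup>2)) (at x)"
      by (simp only: divide_inverse mult.commute)
    show "x \<noteq> 0" using assms by simp
  qed auto
  moreover have "2 * \<bar>a\<bar> * (\<bar>a\<bar> / (1 + (\<bar>a\<bar> * x)\<^sup>2))
      - ((a\<^sup>2 * (2 * x) / (1 + a\<^sup>2 * x\<^sup>2)) * x - ln (1 + a\<^sup>2 * x\<^sup>2)) / (x * x)
      = ln (1 + a\<^sup>2 * x\<^sup>2) / x\<^sup>2"
  proof -
    have "2 * \<bar>a\<bar> * (\<bar>a\<bar> / (1 + (\<bar>a\<bar> * x)\<^sup>2)) = (2 * a\<^sup>2) / (1 + a\<^sup>2 * x\<^sup>2)"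
      by (simp add: power_mult_distrib) (simp add: power2_eq_square abs_mult_self_eq mult.assoc)
    moreover have "((a\<^sup>2 * (2 * x) / (1 + a\<^sup>2 * x\<^sup>2)) * x) / (x * x) = (2 * a\<^sup>2) / (1 + a\<^sup>2 * x\<^sup>2)"
    proof -
      have "(a\<^sup>2 * (2 * x) / (1 + a\<^sup>2 * x\<^sup>2)) * x = (2 * a\<^sup>2) / (1 + a\<^sup>2 * x\<^sup>2) * (x * x)"
        by (simp add: algebra_simps)
      then show ?thesis using assms by simp
    qed
    ultimately show ?thesis by (simp add: diff_divide_distrib power2_eq_square)
  qed
  ultimately show ?thesis unfolding log_primitive_def[abs_def] by simp
qed

lemma log_primitive_at_0: "(log_primitive a \<longlongrightarrow> 0) (at_right 0)"
proof -
  have "((\<lambda>x. 2 * \<bar>a\<bar> * arctan (\<bar>a\<bar> * x)) \<longlongrightarrow> 2 * \<bar>a\<bar> * arctan (\<bar>a\<bar> * 0)) (at_right 0)"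
    by (intro tendsto_intros)
  moreover have "((\<lambda>x. ln (1 + a\<^sup>2 * x\<^sup>2) / x) \<longlongrightarrow> 0) (at_right 0)"
  proof (rule tendsto_sandwich)
    show "eventually (\<lambda>x. 0 \<le> ln (1 + a\<^sup>2 * x\<^sup>2) / x) (at_right 0)"
      by (auto simp: eventually_at_right_less intro!: eventually_at_rightI[of 0 1])
    show "eventually (\<lambda>x. ln (1 + a\<^sup>2 * x\<^sup>2) / x \<le> a\<^sup>2 * x) (at_right 0)"
    proof (rule eventually_at_rightI[of 0 1])
      fix x :: real assume "x \<in> {0<..<1}"
      then have "ln (1 + a\<^sup>2 * x\<^sup>2) / x \<le> (a\<^sup>2 * x\<^sup>2) / x"
        by (intro divide_right_mono ln_add_one_self_le_self) auto
      then show "ln (1 + a\<^sup>2 * x\<^sup>2) / x \<le> a\<^sup>2 * x"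
        using \<open>x \<in> _\<close> by (simp add: power2_eq_square)
    qed simp
    have "((\<lambda>x. a\<^sup>2 * x) \<longlongrightarrow> a\<^sup>2 * 0) (at_right 0)" by (intro tendsto_intros)
    then show "((\<lambda>x. a\<^sup>2 * x) \<longlongrightarrow> 0) (at_right 0)" by simp
  qed simp
  ultimately have "((\<lambda>x. 2 * \<bar>a\<bar> * arctan (\<bar>a\<bar> * x) - ln (1 + a\<^sup>2 * x\<^sup>2) / x)
      \<longlongrightarrow> 2 * \<bar>a\<bar> * arctan (\<bar>a\<bar> * 0) - 0) (at_right 0)"
    by (rule tendsto_diff)
  then show ?thesis unfolding log_primitive_def[abs_def] by simp
qed

lemma log_primitive_at_top: "(log_primitive a \<longlongrightarrow> pi * \<bar>a\<bar>) at_top"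
proof (cases "a = 0")
  case True
  then show ?thesis by (simp add: log_primitive_def[abs_def])
next
  case False
  define b where "b = \<bar>a\<bar>"
  have b: "b > 0" "a\<^sup>2 = b\<^sup>2" using False by (auto simp: b_def)
  have "filterlim (\<lambda>x. b * x) at_top at_top"
    using b by (intro filterlim_tendsto_pos_mult_at_top[OF tendsto_const _ filterlim_ident])
  then have "((\<lambda>x. arctan (b * x)) \<longlongrightarrow> pi / 2) at_top"
    by (rule filterlim_compose[OF tendsto_arctan_at_top])
  then have "((\<lambda>x. 2 * b * arctan (b * x)) \<longlongrightarrow> 2 * b * (pi / 2)) at_top"
    by (intro tendsto_intros)
  moreover have "((\<lambda>x. ln (1 + b\<^sup>2 * x\<^sup>2) / x) \<longlongrightarrow> 0) at_top"
  proof (rule tendsto_sandwich)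
    show "eventually (\<lambda>x. 0 \<le> ln (1 + b\<^sup>2 * x\<^sup>2) / x) at_top"
      using eventually_gt_at_top[of 0] by eventually_elim auto
    show "eventually (\<lambda>x. ln (1 + b\<^sup>2 * x\<^sup>2) / x \<le> 2 * ln (1 + b) / x + 2 * (ln x / x)) at_top"
      using eventually_gt_at_top[of 1]
    proof eventually_elim
      case (elim x)
      have "1 + b\<^sup>2 * x\<^sup>2 \<le> ((1 + b) * x)\<^sup>2"
      proof -
        have "1 \<le> x\<^sup>2" using elim by (simp add: one_le_power)
        moreover have "((1 + b) * x)\<^sup>2 = x\<^sup>2 + 2 * b * x\<^sup>2 + b\<^sup>2 * x\<^sup>2"
          by (simp add: power2_eq_square algebra_simps)
        moreover have "2 * b * x\<^sup>2 \<ge> 0" using b by simp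
        ultimately show ?thesis by linarith
      qed
      moreover have "1 + b\<^sup>2 * x\<^sup>2 > 0" by (simp add: add_pos_nonneg)
      ultimately have "ln (1 + b\<^sup>2 * x\<^sup>2) \<le> ln (((1 + b) * x)\<^sup>2)" by (metis ln_mono)
      also have "\<dots> = 2 * (ln (1 + b) + ln x)"
        using elim b by (simp add: ln_realpow ln_mult)
      finally have "ln (1 + b\<^sup>2 * x\<^sup>2) / x \<le> 2 * (ln (1 + b) + ln x) / x"
        using elim by (intro divide_right_mono) auto
      then show ?case by (simp add: add_divide_distrib algebra_simps)
    qed
    have l: "((\<lambda>x::real. ln x / x) \<longlongrightarrow> 0) at_top"
      by (rule ln_x_over_x_tendsto_0)
    have "((\<lambda>x. 2 * ln (1 + b) / x + 2 * (ln x / x)) \<longlongrightarrow> 0 + 2 * 0) at_top"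
      by (intro tendsto_add tendsto_mult l tendsto_const real_tendsto_divide_at_top[OF tendsto_const filterlim_ident])
    then show "((\<lambda>x. 2 * ln (1 + b) / x + 2 * (ln x / x)) \<longlongrightarrow> 0) at_top" by simp
  qed simp
  ultimately have "((\<lambda>x. 2 * b * arctan (b * x) - ln (1 + b\<^sup>2 * x\<^sup>2) / x)
      \<longlongrightarrow> 2 * b * (pi / 2) - 0) at_top"
    by (rule tendsto_diff)
  then show ?thesis unfolding log_primitive_def[abs_def] b_def by (simp add: mult.commute)
qed

text \<open>
  The difference of the sums of \<open>log_primitive\<close> over \<open>B\<close> and over \<open>A\<close> has the derivative
  \<open>ln (\<Prod>\<^sub>B / \<Prod>\<^sub>A) / x\<^sup>2 \<ge> 0\<close>.  It starts at \<open>0\<close> and ends at \<open>\<pi>\<close> times the difference of the two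
  sums of absolute values.
\<close>

lemma sum_abs_le_if_prod_le:
  fixes A B :: "real multiset"
  assumes le: "\<And>x. x > 0 \<Longrightarrow> (\<Prod>a\<in>#A. 1 + a\<^sup>2 * x\<^sup>2) \<le> (\<Prod>b\<in>#B. 1 + b\<^sup>2 * x\<^sup>2)"
  shows "(\<Sum>a\<in>#A. \<bar>a\<bar>) \<le> (\<Sum>b\<in>#B. \<bar>b\<bar>)"
proof -
  define F where "F C x = (\<Sum>a\<in>#C. log_primitive a x)" for C x
  have pos: "(\<Prod>a\<in>#C. 1 + a\<^sup>2 * x\<^sup>2) > 0" for C and x :: real
  proof (induction C)
    case (add a C)
    have "1 + a\<^sup>2 * x\<^sup>2 > 0" for a :: real by (simp add: add_pos_nonneg)
    then show ?case using add by simp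
  qed simp
  have ln: "ln (\<Prod>a\<in>#C. 1 + a\<^sup>2 * x\<^sup>2) = (\<Sum>a\<in>#C. ln (1 + a\<^sup>2 * x\<^sup>2))" for C and x :: real
  proof (induction C)
    case (add a C)
    have "1 + a\<^sup>2 * x\<^sup>2 > 0" by (simp add: add_pos_nonneg)
    from ln_mult_pos[OF this pos[of x C]] show ?case using add by simp
  qed simp
  have D: "(F C has_real_derivative ln (\<Prod>a\<in>#C. 1 + a\<^sup>2 * x\<^sup>2) / x\<^sup>2) (at x)" if "x > 0" for C x
    unfolding ln F_def[abs_def]
  proof (induction C)
    case (add a C)
    from DERIV_add[OF log_primitive_deriv[OF that, of a] add] show ?case
      by (simp add: add_divide_distrib)
  qed simp
  have F0: "(F C \<longlongrightarrow> 0) (at_right 0)" for C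
    unfolding F_def[abs_def]
  proof (induction C)
    case (add a C)
    from tendsto_add[OF log_primitive_at_0[of a] add] show ?case by simp
  qed simp
  have Ftop: "(F C \<longlongrightarrow> pi * (\<Sum>a\<in>#C. \<bar>a\<bar>)) at_top" for C
    unfolding F_def[abs_def]
  proof (induction C)
    case (add a C)
    from tendsto_add[OF log_primitive_at_top[of a] add] show ?case by (simp add: algebra_simps)
  qed simp
  define G where "G x = F B x - F A x" for x
  have mono: "G x \<le> G y" if "0 < x" "x \<le> y" for x y
  proof (rule DERIV_nonneg_imp_nondecreasing[OF that(2)])
    fix z assume "x \<le> z" "z \<le> y"
    then have z: "z > 0" using that by simp
    have "(G has_real_derivative ln (\<Prod>a\<in>#B. 1 + a\<^sup>2 * z\<^sup>2) / z\<^sup>2 - ln (\<Prod>a\<in>#A. 1 + a\<^sup>2 * z\<^sup>2) / z\<^sup>2) (at z)"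
      unfolding G_def[abs_def] by (intro DERIV_diff D z)
    moreover have "ln (\<Prod>a\<in>#A. 1 + a\<^sup>2 * z\<^sup>2) \<le> ln (\<Prod>a\<in>#B. 1 + a\<^sup>2 * z\<^sup>2)"
      using le[OF z] pos by simp
    then have "ln (\<Prod>a\<in>#B. 1 + a\<^sup>2 * z\<^sup>2) / z\<^sup>2 - ln (\<Prod>a\<in>#A. 1 + a\<^sup>2 * z\<^sup>2) / z\<^sup>2 \<ge> 0"
      by (simp add: divide_right_mono)
    ultimately show "\<exists>d. (G has_real_derivative d) (at z) \<and> 0 \<le> d" by blast
  qed
  have G0: "(G \<longlongrightarrow> 0) (at_right 0)"
    using tendsto_diff[OF F0[of B] F0[of A]] by (simp add: G_def[abs_def])
  have nonneg: "G y \<ge> 0" if "y > 0" for y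
  proof (rule tendsto_upperbound[OF G0])
    show "eventually (\<lambda>x. G x \<le> G y) (at_right 0)"
      using that by (intro eventually_at_rightI[of 0 y] mono) auto
  qed simp
  have "(G \<longlongrightarrow> pi * (\<Sum>b\<in>#B. \<bar>b\<bar>) - pi * (\<Sum>a\<in>#A. \<bar>a\<bar>)) at_top"
    unfolding G_def[abs_def] by (intro tendsto_diff Ftop)
  then have "0 \<le> pi * (\<Sum>b\<in>#B. \<bar>b\<bar>) - pi * (\<Sum>a\<in>#A. \<bar>a\<bar>)"
  proof (rule tendsto_lowerbound)
    show "eventually (\<lambda>x. 0 \<le> G x) at_top"
      using eventually_gt_at_top[of 0] by eventually_elim (rule nonneg)
  qed simp
  then have "pi * (\<Sum>a\<in>#A. \<bar>a\<bar>) \<le> pi * (\<Sum>b\<in>#B. \<bar>b\<bar>)" by linarith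
  then show ?thesis by (simp only: mult_le_cancel_left_pos[OF pi_gt_zero])
qed

section \<open>Determinants over finite index sets\<close>

text \<open>
  The determinant with rows and columns indexed by a finite set, which makes the deletion of
  vertices and the renaming of vertices immediate.
\<close>

definition set_det :: "'a set \<Rightarrow> ('a \<Rightarrow> 'a \<Rightarrow> complex) \<Rightarrow> complex" where
  "set_det V f = (\<Sum>p | p permutes V. of_int (sign p) * (\<Prod>i\<in>V. f i (p i)))"

lemma set_det_empty [simp]: "set_det {} f = 1"
  by (simp add: set_det_def)

lemma set_det_cong:
  assumes "\<And>u v. u \<in> V \<Longrightarrow> v \<in> V \<Longrightarrow> f u v = g u v"
  shows "set_det V f = set_det V g"
  unfolding set_det_def
  by (intro sum.cong refl arg_cong2[of _ _ _ _ "(*)"] prod.cong)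
     (use assms in \<open>auto dest: permutes_in_image\<close>)

lemma set_det_reindex:
  assumes h: "bij_betw h A B" and fin: "finite A"
  shows "set_det B f = set_det A (\<lambda>i j. f (h i) (h j))"
proof -
  have inj: "inj_on h A" using h by (simp add: bij_betw_def)
  have B: "B = h ` A" using h by (simp add: bij_betw_def)
  have finB: "finite B" using fin B by simp
  have inv: "bij_betw (inv_into A h) B A" using h by (rule bij_betw_inv_into)
  have "bij_betw (map_permutation A h) {p. p permutes A} {p. p permutes B}"
  proof (rule bij_betw_byWitness[where f' = "map_permutation B (inv_into A h)"])
    show "\<forall>a\<in>{p. p permutes A}. map_permutation B (inv_into A h) (map_permutation A h a) = a"
    proof clarify
      fix a assume a: "a permutes A"
      show "map_permutation B (inv_into A h) (map_permutation A h a) = a"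
        by (rule map_permutation_compose_inv[OF h a]) (use inj in auto)
    qed
    show "\<forall>a'\<in>{p. p permutes B}. map_permutation A h (map_permutation B (inv_into A h) a') = a'"
    proof clarify
      fix a assume a: "a permutes B"
      show "map_permutation A h (map_permutation B (inv_into A h) a) = a"
        by (rule map_permutation_compose_inv[OF inv a]) (use B in \<open>auto simp: f_inv_into_f\<close>)
    qed
    show "map_permutation A h ` {p. p permutes A} \<subseteq> {p. p permutes B}"
      using map_permutation_permutes[OF h] by auto
    show "map_permutation B (inv_into A h) ` {p. p permutes B} \<subseteq> {p. p permutes A}"
      using map_permutation_permutes[OF inv] by auto
  qed
  then have "set_det B f = (\<Sum>p | p permutes A.
      of_int (sign (map_permutation A h p)) * (\<Prod>i\<in>B. f i (map_permutation A h p i)))"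
    unfolding set_det_def by (intro sum.reindex_bij_betw[symmetric])
  also have "\<dots> = set_det A (\<lambda>i j. f (h i) (h j))"
    unfolding set_det_def
  proof (intro sum.cong refl)
    fix p assume "p \<in> {p. p permutes A}"
    then have p: "p permutes A" by simp
    have "(\<Prod>i\<in>B. f i (map_permutation A h p i)) = (\<Prod>i\<in>A. f (h i) (map_permutation A h p (h i)))"
      by (rule prod.reindex_bij_betw[OF h, symmetric])
    also have "\<dots> = (\<Prod>i\<in>A. f (h i) (h (p i)))"
      using map_permutation_apply[OF inj] by (intro prod.cong) auto
    finally show "of_int (sign (map_permutation A h p)) * (\<Prod>i\<in>B. f i (map_permutation A h p i))
       = of_int (sign p) * (\<Prod>i\<in>A. f (h i) (h (p i)))"
      using sign_map_permutation[OF inj p fin] by simp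
  qed
  finally show ?thesis .
qed

lemma det_eq_set_det:
  assumes "A \<in> carrier_mat n n"
  shows "det A = set_det {0..<n} (\<lambda>i j. A $$ (i, j))"
  unfolding det_def'[OF assms] set_det_def by simp

lemma sum_perm_fixing:
  assumes "finite V" "v \<in> V"
  shows "(\<Sum>p | p permutes V \<and> p v = v. of_int (sign p) * (\<Prod>i\<in>V. f i (p i)))
           = f v v * set_det (V - {v}) f"
proof -
  have eq: "{p. p permutes V \<and> p v = v} = {p. p permutes (V - {v})}"
  proof (intro Set.set_eqI iffI)
    fix p assume "p \<in> {p. p permutes V \<and> p v = v}"
    then show "p \<in> {p. p permutes (V - {v})}" using permutes_superset[of p V "V - {v}"] by blast
  next
    fix p assume "p \<in> {p. p permutes (V - {v})}"
    then have p: "p permutes (V - {v})" by simp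
    have "p permutes V" by (rule permutes_subset[OF p]) auto
    then show "p \<in> {p. p permutes V \<and> p v = v}" using permutes_not_in[OF p] by simp
  qed
  have "(\<Prod>i\<in>V. f i (p i)) = f v v * (\<Prod>i\<in>V - {v}. f i (p i))" if "p permutes (V - {v})" for p
    using prod.remove[OF assms, of "\<lambda>i. f i (p i)"] permutes_not_in[OF that, of v] by simp
  then show ?thesis
    unfolding eq set_det_def sum_distrib_left
    by (intro sum.cong refl) (simp add: algebra_simps)
qed

lemma sum_perm_swapping:
  assumes fin: "finite V" and "v \<in> V" "u \<in> V" "u \<noteq> v"
  shows "(\<Sum>p | p permutes V \<and> p v = u \<and> p u = v. of_int (sign p) * (\<Prod>i\<in>V. f i (p i)))
           = - f v u * f u v * set_det (V - {u, v}) f"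
proof -
  let ?W = "V - {u, v}" and ?t = "Transposition.transpose u v"
  have tV: "?t permutes V" using assms by (intro permutes_swap_id)
  have "bij_betw (\<lambda>p. ?t \<circ> p) {p. p permutes ?W} {p. p permutes V \<and> p v = u \<and> p u = v}"
  proof (rule bij_betw_byWitness[where f' = "\<lambda>p. ?t \<circ> p"])
    show "\<forall>a\<in>{p. p permutes ?W}. ?t \<circ> (?t \<circ> a) = a" by (simp add: o_assoc)
    show "\<forall>a'\<in>{p. p permutes V \<and> p v = u \<and> p u = v}. ?t \<circ> (?t \<circ> a') = a'" by (simp add: o_assoc)
    show "(\<lambda>p. ?t \<circ> p) ` {p. p permutes ?W} \<subseteq> {p. p permutes V \<and> p v = u \<and> p u = v}"
    proof
      fix q assume "q \<in> (\<lambda>p. ?t \<circ> p) ` {p. p permutes ?W}"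
      then obtain p where q: "q = ?t \<circ> p" and p: "p permutes ?W" by auto
      have "p permutes V" by (rule permutes_subset[OF p]) auto
      then have "q permutes V" unfolding q using permutes_compose tV by blast
      moreover have "p u = u" "p v = v" using permutes_not_in[OF p] by auto
      ultimately show "q \<in> {p. p permutes V \<and> p v = u \<and> p u = v}" by (simp add: q)
    qed
    show "(\<lambda>p. ?t \<circ> p) ` {p. p permutes V \<and> p v = u \<and> p u = v} \<subseteq> {p. p permutes ?W}"
    proof
      fix q assume "q \<in> (\<lambda>p. ?t \<circ> p) ` {p. p permutes V \<and> p v = u \<and> p u = v}"
      then obtain p where q: "q = ?t \<circ> p" and p: "p permutes V" "p v = u" "p u = v" by auto
      have "q permutes V" unfolding q by (rule permutes_compose[OF p(1) tV])
      moreover have "q x = x" if "x \<in> V - ?W" for x using that p by (auto simp: q)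
      ultimately show "q \<in> {p. p permutes ?W}" using permutes_superset[of q V ?W] by blast
    qed
  qed
  then have "(\<Sum>p | p permutes V \<and> p v = u \<and> p u = v. of_int (sign p) * (\<Prod>i\<in>V. f i (p i)))
     = (\<Sum>p | p permutes ?W. of_int (sign (?t \<circ> p)) * (\<Prod>i\<in>V. f i ((?t \<circ> p) i)))"
    by (rule sum.reindex_bij_betw[symmetric])
  also have "\<dots> = (\<Sum>p | p permutes ?W. - f v u * f u v * (of_int (sign p) * (\<Prod>i\<in>?W. f i (p i))))"
  proof (intro sum.cong refl)
    fix p assume "p \<in> {p. p permutes ?W}"
    then have p: "p permutes ?W" by simp
    have "permutation p" using permutes_imp_permutation[OF _ p] fin by simp
    then have s: "sign (?t \<circ> p) = - sign p"
      using assms by (simp add: sign_compose permutation_swap_id sign_swap_id)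
    have V: "V = insert u (insert v ?W)" using assms by auto
    have "(\<Prod>i\<in>V. f i ((?t \<circ> p) i)) = f u ((?t \<circ> p) u) * (f v ((?t \<circ> p) v) * (\<Prod>i\<in>?W. f i ((?t \<circ> p) i)))"
      using fin assms by (subst V) simp
    moreover have "p u = u" "p v = v" using permutes_not_in[OF p] by auto
    moreover have "(\<Prod>i\<in>?W. f i ((?t \<circ> p) i)) = (\<Prod>i\<in>?W. f i (p i))"
    proof (intro prod.cong refl)
      fix i assume "i \<in> ?W"
      then have "p i \<in> ?W" using permutes_in_image[OF p] by simp
      then show "f i ((?t \<circ> p) i) = f i (p i)" by simp
    qed
    ultimately show "of_int (sign (?t \<circ> p)) * (\<Prod>i\<in>V. f i ((?t \<circ> p) i))
      = - f v u * f u v * (of_int (sign p) * (\<Prod>i\<in>?W. f i (p i)))"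
      by (simp add: s)
  qed
  finally show ?thesis by (simp only: set_det_def sum_distrib_left)
qed

lemma set_det_isolated:
  assumes "finite V" "v \<in> V" "f v v = 1" "\<And>w. w \<in> V \<Longrightarrow> w \<noteq> v \<Longrightarrow> f v w = 0"
  shows "set_det V f = set_det (V - {v}) f"
proof -
  have "set_det V f = (\<Sum>p | p permutes V \<and> p v = v. of_int (sign p) * (\<Prod>i\<in>V. f i (p i)))"
    unfolding set_det_def
  proof (rule sum.mono_neutral_right)
    show "\<forall>p\<in>{p. p permutes V} - {p. p permutes V \<and> p v = v}.
        of_int (sign p) * (\<Prod>i\<in>V. f i (p i)) = 0"
    proof
      fix p assume "p \<in> {p. p permutes V} - {p. p permutes V \<and> p v = v}"
      then have p: "p permutes V" "p v \<noteq> v" by auto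
      then have "f v (p v) = 0" using assms permutes_in_image[OF p(1), of v] by simp
      then show "of_int (sign p) * (\<Prod>i\<in>V. f i (p i)) = 0" using assms by (auto intro: prod_zero)
    qed
  qed (use assms in \<open>auto intro: finite_permutations\<close>)
  then show ?thesis using sum_perm_fixing[OF assms(1,2)] assms(3) by simp
qed

text \<open>
  In a nonzero term of the determinant, the permutation either fixes \<open>v\<close> or exchanges \<open>v\<close> with
  its only neighbour \<open>u\<close>.
\<close>

lemma set_det_pendant:
  assumes fin: "finite V" and vu: "v \<in> V" "u \<in> V" "u \<noteq> v" and "f v v = 1"
    and row: "\<And>w. w \<in> V \<Longrightarrow> w \<noteq> v \<Longrightarrow> w \<noteq> u \<Longrightarrow> f v w = 0"
    and col: "\<And>w. w \<in> V \<Longrightarrow> w \<noteq> v \<Longrightarrow> w \<noteq> u \<Longrightarrow> f w v = 0"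
  shows "set_det V f = set_det (V - {v}) f - f v u * f u v * set_det (V - {u, v}) f"
proof -
  let ?P = "{p. p permutes V \<and> p v = v}" and ?S = "{p. p permutes V \<and> p v = u \<and> p u = v}"
  let ?g = "\<lambda>p. of_int (sign p) * (\<Prod>i\<in>V. f i (p i)) :: complex"
  have finP: "finite {p. p permutes V}" using fin by (rule finite_permutations)
  have "set_det V f = sum ?g (?P \<union> ?S)"
    unfolding set_det_def
  proof (rule sum.mono_neutral_right[OF finP])
    show "\<forall>p\<in>{p. p permutes V} - (?P \<union> ?S). ?g p = 0"
    proof
      fix p assume "p \<in> {p. p permutes V} - (?P \<union> ?S)"
      then have p: "p permutes V" "p v \<noteq> v" "p v = u \<Longrightarrow> p u \<noteq> v" by auto
      have "\<exists>i\<in>V. f i (p i) = 0"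
      proof (cases "p v = u")
        case False
        then show ?thesis using row[of "p v"] p permutes_in_image[OF p(1), of v] vu by auto
      next
        case True
        obtain w where w: "p w = v" "w \<in> V"
          using permutes_surj[OF p(1)] permutes_in_image[OF p(1)] vu(1) by (metis surjD)
        have "w \<noteq> v" "w \<noteq> u" using w p True by metis+
        then have "f w (p w) = 0" using col[of w] w by simp
        then show ?thesis using w by blast
      qed
      then show "?g p = 0" using fin by (auto intro: prod_zero)
    qed
  qed auto
  also have "\<dots> = sum ?g ?P + sum ?g ?S"
    using vu by (intro sum.union_disjoint finite_subset[OF _ finP]) auto
  finally show ?thesis
    using sum_perm_fixing[OF fin vu(1), of f] sum_perm_swapping[OF fin vu, of f] assms(5) by simp
qed

section \<open>Determinants of paths and cycles\<close>

lemma set_det_path: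
  assumes "\<And>i. i \<in> {a..<a + k} \<Longrightarrow> g i i = 1"
    and "\<And>i j. i \<in> {a..<a + k} \<Longrightarrow> j \<in> {a..<a + k} \<Longrightarrow> Suc i < j \<Longrightarrow> g i j = 0 \<and> g j i = 0"
    and "\<And>i. a \<le> i \<Longrightarrow> Suc i < a + k \<Longrightarrow> g i (Suc i) * g (Suc i) i = - of_real t"
  shows "set_det {a..<a + k} g = of_real (path_poly k t)"
  using assms
proof (induction k rule: less_induct)
  case (less k)
  consider "k = 0" | "k = 1" | m where "k = Suc (Suc m)" by (metis One_nat_def not0_implies_Suc)
  then show ?case
  proof cases
    case 2
    then show ?thesis using set_det_isolated[of "{a}" a g] less.prems(1) by (simp add: atLeastLessThanSuc)
  next
    case (3 m)
    let ?V = "{a..<a + k}" and ?v = "a + Suc m" and ?u = "a + m"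
    have "set_det ?V g = set_det (?V - {?v}) g - g ?v ?u * g ?u ?v * set_det (?V - {?u, ?v}) g"
    proof (rule set_det_pendant)
      show "g ?v w = 0" "g w ?v = 0" if "w \<in> ?V" "w \<noteq> ?v" "w \<noteq> ?u" for w
        using less.prems(2)[of w ?v] that 3 by auto
    qed (use less.prems(1) 3 in auto)
    moreover have "?V - {?v} = {a..<a + Suc m}" "?V - {?u, ?v} = {a..<a + m}" using 3 by auto
    moreover have "set_det {a..<a + Suc m} g = of_real (path_poly (Suc m) t)"
      using 3 by (intro less.IH less.prems) auto
    moreover have "set_det {a..<a + m} g = of_real (path_poly m t)"
      using 3 by (intro less.IH less.prems) auto
    moreover have "g ?v ?u * g ?u ?v = - of_real t" using less.prems(3)[of ?u] 3 by (simp add: mult.commute)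
    ultimately show ?thesis using 3 by simp
  qed simp
qed

definition rotation :: "nat \<Rightarrow> nat \<Rightarrow> nat" where
  "rotation l i = (if i < l then Suc i mod l else i)"

lemma rotation_Suc: "l \<ge> 1 \<Longrightarrow> rotation (Suc l) = Transposition.transpose 0 l \<circ> rotation l"
  by (auto simp: rotation_def fun_eq_iff Transposition.transpose_def mod_Suc)

lemma rotation_permutes_sign:
  "rotation (Suc l) permutes {0..<Suc l} \<and> sign (rotation (Suc l)) = (- 1) ^ l"
proof (induction l)
  case 0
  have r: "rotation (Suc 0) = id" by (rule ext) (simp add: rotation_def)
  show ?case unfolding r by (intro conjI permutes_id) simp
next
  case (Suc l)
  have p: "rotation (Suc l) permutes {0..<Suc (Suc l)}"
    by (rule permutes_subset[OF conjunct1[OF Suc]]) auto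
  have t: "Transposition.transpose 0 (Suc l) permutes {0..<Suc (Suc l)}"
    by (rule permutes_swap_id) auto
  have "rotation (Suc (Suc l)) permutes {0..<Suc (Suc l)}"
    unfolding rotation_Suc[of "Suc l", simplified] by (rule permutes_compose[OF p t])
  moreover have "sign (rotation (Suc (Suc l))) = - sign (rotation (Suc l))"
    unfolding rotation_Suc[of "Suc l", simplified]
    using permutes_imp_permutation[OF _ p] permutation_swap_id[of 0 "Suc l"]
    by (simp add: sign_compose sign_swap_id)
  ultimately show ?case using Suc by simp
qed

text \<open>
  A permutation with a nonzero term moves every vertex by at most one step along the cycle.  Either
  it does not touch the vertex \<open>0\<close>, or it exchanges \<open>0\<close> with one of its two neighbours, or it is
  one of the two rotations of the whole cycle.  The first three classes give the matching polynomial
  of the cycle, the rotations give the cycle term.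
\<close>

lemma set_det_cycle:
  fixes g :: "nat \<Rightarrow> nat \<Rightarrow> complex"
  assumes l: "l \<ge> 3"
    and diag: "\<And>i. i < l \<Longrightarrow> g i i = 1"
    and zero: "\<And>i j. i < l \<Longrightarrow> j < l \<Longrightarrow> i \<noteq> j \<Longrightarrow> j \<noteq> Suc i mod l \<Longrightarrow> i \<noteq> Suc j mod l \<Longrightarrow> g i j = 0"
    and edge: "\<And>i. i < l \<Longrightarrow> g i (Suc i mod l) * g (Suc i mod l) i = - of_real t"
  shows "set_det {0..<l} g = of_real (tadpole_poly l 0 t)
      + (- 1) ^ (l - 1) * ((\<Prod>i<l. g i (Suc i mod l)) + (\<Prod>i<l. g (Suc i mod l) i))"
proof -
  let ?V = "{0..<l}" and ?r = "rotation l"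
  let ?h = "\<lambda>p. of_int (sign p) * (\<Prod>i\<in>?V. g i (p i)) :: complex"
  let ?F = "{p. p permutes ?V \<and> p 0 = 0}"
  let ?S1 = "{p. p permutes ?V \<and> p 0 = 1 \<and> p 1 = 0}"
  let ?S2 = "{p. p permutes ?V \<and> p 0 = l - 1 \<and> p (l - 1) = 0}"
  have r: "?r permutes ?V" "sign ?r = (- 1) ^ (l - 1)"
    using rotation_permutes_sign[of "l - 1"] l by auto
  define q where "q = inv_into UNIV ?r"
  have q: "q permutes ?V" "sign q = (- 1) ^ (l - 1)"
    unfolding q_def using permutes_inv[OF r(1)] sign_inverse[OF permutes_imp_permutation[OF _ r(1)]] r(2) by auto
  have qr: "q (?r i) = i" for i unfolding q_def using permutes_inverses(2)[OF r(1)] .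
  have fin: "finite {p. p permutes ?V}" by (rule finite_permutations) simp
  have r0: "?r 0 = 1" "?r 1 = 2 mod l" using l by (auto simp: rotation_def)
  have "?r (l - 1) = 0" "?r (l - 2) = l - 1" using l by (auto simp: rotation_def Suc_diff_Suc numeral_eq_Suc)
  then have q0: "q 0 = l - 1" "q (l - 1) = l - 2" using qr by metis+
  have cover: "?h p = 0" if p: "p permutes ?V" "p \<notin> ?F \<union> ?S1 \<union> ?S2 \<union> {?r, q}" for p
  proof (rule ccontr)
    assume "?h p \<noteq> 0"
    then have nz: "g i (p i) \<noteq> 0" if "i < l" for i using that by (auto simp: prod_zero_iff)
    have pl: "p i < l" if "i < l" for i using permutes_in_image[OF p(1), of i] that by simp
    have inj: "p i = p j \<longleftrightarrow> i = j" for i j using permutes_inj[OF p(1)] by (auto dest: injD)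
    have cases: "p i = i \<or> p i = Suc i mod l \<or> i = Suc (p i) mod l" if "i < l" for i
      using zero[OF that pl[OF that]] nz[OF that] by metis
    have "p 0 \<noteq> 0" using p by auto
    \<comment> \<open>The two cases lead to the two rotations: each further image is forced, as the vertex
      behind is already taken.\<close>
    then consider "p 0 = 1" "p 1 \<noteq> 0" | "p 0 = l - 1" "p (l - 1) \<noteq> 0"
      using cases[of 0] pl[of 0] p l by (auto simp: mod_Suc split: if_splits)
    then show False
    proof cases
      case 1
      have step: "p i = Suc i mod l" if "i < l" for i
        using that
      proof (induction i rule: less_induct)
        case (less i)
        show ?case
        proof (cases "i = 0")
          case True
          then show ?thesis using 1 l by simp
        next
          case False
          then have "p (i - 1) = i" using less.IH[of "i - 1"] less.prems by simp
          then have "p i \<noteq> i" using inj[of i "i - 1"] False by auto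
          moreover have "i \<noteq> Suc (p i) mod l"
          proof
            assume "i = Suc (p i) mod l"
            then have pi: "p i = i - 1" using False pl[OF less.prems] by (auto simp: mod_Suc split: if_splits)
            show False
            proof (cases "i = 1")
              case True
              then show ?thesis using pi 1 by simp
            next
              case i1: False
              then have "p (i - 2) = i - 1" using less.IH[of "i - 2"] less.prems False
                by (simp add: Suc_diff_Suc numeral_eq_Suc)
              then show False using pi inj[of i "i - 2"] False by auto
            qed
          qed
          ultimately show ?thesis using cases[OF less.prems] by simp
        qed
      qed
      have "p = ?r"
      proof
        fix i show "p i = ?r i" using step permutes_not_in[OF p(1), of i] by (auto simp: rotation_def)
      qed
      then show False using p by simp
    next
      case 2
      have step: "p (l - 1 - k) = l - 2 - k" if "k < l - 1" for k
        using that
      proof (induction k rule: less_induct)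
        case (less k)
        define i where "i = l - 1 - k"
        have i: "i < l" "i > 0" using less.prems l by (auto simp: i_def)
        have a: "p i \<noteq> i"
        proof (cases "k = 0")
          case True
          then show ?thesis using 2 inj[of i 0] i by (auto simp: i_def)
        next
          case False
          then have "p (Suc i) = i" using less.IH[of "k - 1"] less.prems l
            by (auto simp: i_def Suc_diff_Suc numeral_eq_Suc)
          then show ?thesis using inj[of i "Suc i"] by auto
        qed
        have b: "p i \<noteq> Suc i mod l"
        proof
          assume pi: "p i = Suc i mod l"
          consider "k = 0" | "k = 1" | "k \<ge> 2" by linarith
          then show False
          proof cases
            case 1
            then show False using pi 2 l by (simp add: i_def)
          next
            case k: 2
            then have "Suc i = l - 1" using l by (simp add: i_def)
            then show False using pi inj[of i 0] 2 i by simp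
          next
            case 3
            then have "l - 1 - (k - 2) = Suc (Suc i)" "l - 2 - (k - 2) = Suc i"
              using less.prems by (auto simp: i_def)
            then have "p (Suc (Suc i)) = Suc i" using less.IH[of "k - 2"] less.prems 3 by simp
            moreover have "Suc i < l" using 3 l by (simp add: i_def)
            ultimately show False using pi inj[of i "Suc (Suc i)"] by simp
          qed
        qed
        have "i = Suc (p i) mod l" using cases[OF i(1)] a b by simp
        then have "p i = i - 1" using i pl[OF i(1)] by (auto simp: mod_Suc split: if_splits)
        then show ?case by (simp add: i_def)
      qed
      have "p = q"
      proof
        fix i
        have "p (?r j) = j" for j
        proof (cases "j < l - 1")
          case True
          then have "?r j = l - 1 - (l - 2 - j)" using l by (auto simp: rotation_def)
          then show ?thesis using step[of "l - 2 - j"] True l by simp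
        next
          case False
          show ?thesis
          proof (cases "j = l - 1")
            case True
            then show ?thesis using 2 l by (simp add: rotation_def)
          next
            case j: False
            then have "\<not> j < l" using False l by linarith
            then show ?thesis using permutes_not_in[OF p(1), of j] by (simp add: rotation_def)
          qed
        qed
        moreover obtain j where "?r j = i" using permutes_surj[OF r(1)] by (metis surjD)
        ultimately show "p i = q i" using qr by metis
      qed
      then show False using p by simp
    qed
  qed
  have disj: "?F \<inter> ?S1 = {}" "(?F \<union> ?S1) \<inter> ?S2 = {}" "(?F \<union> ?S1 \<union> ?S2) \<inter> {?r, q} = {}" "?r \<noteq> q"
    using l r0 q0 by (auto simp: mod_Suc)
  have "set_det ?V g = sum ?h (?F \<union> ?S1 \<union> ?S2 \<union> {?r, q})"
    unfolding set_det_def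
    by (rule sum.mono_neutral_right[OF fin]) (use r q cover in auto)
  also have "\<dots> = sum ?h ?F + sum ?h ?S1 + sum ?h ?S2 + (?h ?r + ?h q)"
  proof -
    have f: "finite ?F" "finite ?S1" "finite ?S2" by (auto intro: finite_subset[OF _ fin])
    have "sum ?h (?F \<union> ?S1 \<union> ?S2 \<union> {?r, q}) = sum ?h (?F \<union> ?S1 \<union> ?S2) + sum ?h {?r, q}"
      using f disj by (intro sum.union_disjoint) auto
    also have "sum ?h (?F \<union> ?S1 \<union> ?S2) = sum ?h (?F \<union> ?S1) + sum ?h ?S2"
      using f disj by (intro sum.union_disjoint) auto
    also have "sum ?h (?F \<union> ?S1) = sum ?h ?F + sum ?h ?S1"
      using f disj by (intro sum.union_disjoint) auto
    also have "sum ?h {?r, q} = ?h ?r + ?h q" using disj by simp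
    finally show ?thesis .
  qed
  also have "sum ?h ?F = of_real (path_poly (l - 1) t)"
  proof -
    have "sum ?h ?F = g 0 0 * set_det (?V - {0}) g" using l by (intro sum_perm_fixing) auto
    also have "?V - {0} = {1..<1 + (l - 1)}" using l by auto
    also have "set_det {1..<1 + (l - 1)} g = of_real (path_poly (l - 1) t)"
    proof (rule set_det_path)
      show "g i i = 1" if "i \<in> {1..<1 + (l - 1)}" for i using diag that l by auto
      show "g i j = 0 \<and> g j i = 0" if "i \<in> {1..<1 + (l - 1)}" "j \<in> {1..<1 + (l - 1)}" "Suc i < j" for i j
        using that zero[of i j] zero[of j i] l by (auto simp: mod_Suc)
      show "g i (Suc i) * g (Suc i) i = - of_real t" if "1 \<le> i" "Suc i < 1 + (l - 1)" for i
      proof -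
        have "Suc i < l" using that l by linarith
        then show ?thesis using edge[of i] by simp
      qed
    qed
    finally show ?thesis using diag[of 0] l by simp
  qed
  also have "sum ?h ?S1 = of_real (t * path_poly (l - 2) t)"
  proof -
    have "sum ?h ?S1 = - g 0 1 * g 1 0 * set_det (?V - {1, 0}) g"
      using l by (intro sum_perm_swapping) auto
    also have "?V - {1, 0} = {2..<2 + (l - 2)}" using l by auto
    also have "set_det {2..<2 + (l - 2)} g = of_real (path_poly (l - 2) t)"
    proof (rule set_det_path)
      show "g i i = 1" if "i \<in> {2..<2 + (l - 2)}" for i using diag that l by auto
      show "g i j = 0 \<and> g j i = 0" if "i \<in> {2..<2 + (l - 2)}" "j \<in> {2..<2 + (l - 2)}" "Suc i < j" for i j
        using that zero[of i j] zero[of j i] l by (auto simp: mod_Suc)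
      show "g i (Suc i) * g (Suc i) i = - of_real t" if "2 \<le> i" "Suc i < 2 + (l - 2)" for i
      proof -
        have "Suc i < l" using that l by linarith
        then show ?thesis using edge[of i] by simp
      qed
    qed
    finally show ?thesis using edge[of 0] l by simp
  qed
  also have "sum ?h ?S2 = of_real (t * path_poly (l - 2) t)"
  proof -
    have "sum ?h ?S2 = - g 0 (l - 1) * g (l - 1) 0 * set_det (?V - {l - 1, 0}) g"
      using l by (intro sum_perm_swapping) auto
    also have "?V - {l - 1, 0} = {1..<1 + (l - 2)}" using l by auto
    also have "set_det {1..<1 + (l - 2)} g = of_real (path_poly (l - 2) t)"
    proof (rule set_det_path)
      show "g i i = 1" if "i \<in> {1..<1 + (l - 2)}" for i using diag that l by auto
      show "g i j = 0 \<and> g j i = 0" if "i \<in> {1..<1 + (l - 2)}" "j \<in> {1..<1 + (l - 2)}" "Suc i < j" for i j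
        using that zero[of i j] zero[of j i] l by (auto simp: mod_Suc)
      show "g i (Suc i) * g (Suc i) i = - of_real t" if "1 \<le> i" "Suc i < 1 + (l - 2)" for i
      proof -
        have "Suc i < l" using that l by linarith
        then show ?thesis using edge[of i] by simp
      qed
    qed
    finally show ?thesis using edge[of "l - 1"] l by (simp add: mult.commute)
  qed
  also have "?h ?r = (- 1) ^ (l - 1) * (\<Prod>i<l. g i (Suc i mod l))"
    using r(2) by (simp add: rotation_def atLeast0LessThan)
  also have "?h q = (- 1) ^ (l - 1) * (\<Prod>i<l. g (Suc i mod l) i)"
  proof -
    have "(\<Prod>i\<in>?V. g i (q i)) = (\<Prod>i\<in>?V. g (?r i) (q (?r i)))"
      using prod.permute[OF r(1), of "\<lambda>i. g i (q i)"] by (simp add: o_def)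
    also have "\<dots> = (\<Prod>i<l. g (Suc i mod l) i)"
      unfolding qr by (simp add: rotation_def atLeast0LessThan)
    finally show ?thesis using q(2) by simp
  qed
  finally have "set_det ?V g = of_real (path_poly (l - 1) t + 2 * t * path_poly (l - 2) t)
     + (- 1) ^ (l - 1) * ((\<Prod>i<l. g i (Suc i mod l)) + (\<Prod>i<l. g (Suc i mod l) i))"
    by (simp add: algebra_simps)
  moreover have "path_poly (l - 1) t + 2 * t * path_poly (l - 2) t = tadpole_poly l 0 t"
  proof -
    obtain m where "l = Suc (Suc m)" using l by (metis add_2_eq_Suc le_Suc_ex numeral_3_eq_3 add_Suc)
    then show ?thesis by (simp add: tadpole_poly_def)
  qed
  ultimately show ?thesis by (simp only:)
qed

section \<open>The energy as a function of a determinant\<close>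

lemma hermitian_eigenvalue_real:
  fixes A :: "complex mat"
  assumes A: "A \<in> carrier_mat n n"
    and herm: "\<And>i j. i < n \<Longrightarrow> j < n \<Longrightarrow> A $$ (j, i) = cnj (A $$ (i, j))"
    and ev: "eigenvalue A k"
  shows "k \<in> \<real>"
proof -
  obtain v where v: "v \<in> carrier_vec n" "v \<noteq> 0\<^sub>v n" "A *\<^sub>v v = k \<cdot>\<^sub>v v"
    using ev A unfolding eigenvalue_def eigenvector_def by auto
  define S where "S = (\<Sum>i<n. \<Sum>j<n. cnj (v $ i) * A $$ (i, j) * v $ j)"
  define N where "N = (\<Sum>i<n. (cmod (v $ i))\<^sup>2)"
  have "S = (\<Sum>i<n. cnj (v $ i) * (A *\<^sub>v v) $ i)"
    unfolding S_def using A v(1)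
    by (intro sum.cong refl)
       (simp add: scalar_prod_def sum_distrib_left mult.assoc atLeast0LessThan)
  also have "\<dots> = k * of_real N"
  proof -
    have "cnj (v $ i) * (A *\<^sub>v v) $ i = k * of_real ((cmod (v $ i))\<^sup>2)" if "i < n" for i
    proof -
      have "(k \<cdot>\<^sub>v v) $ i = k * v $ i" using that v(1) by simp
      then show ?thesis unfolding complex_norm_square v(3) by (simp only: mult_ac)
    qed
    then show ?thesis unfolding N_def of_real_sum sum_distrib_left by (intro sum.cong refl) blast
  qed
  finally have S: "S = k * of_real N" .
  have "cnj S = (\<Sum>i<n. \<Sum>j<n. cnj (v $ j) * A $$ (j, i) * v $ i)"
  proof -
    have "cnj (cnj (v $ i) * A $$ (i, j) * v $ j) = cnj (v $ j) * A $$ (j, i) * v $ i"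
      if "i < n" "j < n" for i j
      by (simp only: herm[OF that] complex_cnj_mult complex_cnj_cnj mult_ac)
    then show ?thesis unfolding S_def cnj_sum by (intro sum.cong refl) blast
  qed
  also have "\<dots> = S" unfolding S_def by (rule sum.swap)
  finally have "cnj S = S" .
  moreover have "N > 0"
  proof -
    obtain i where i: "i < n" "v $ i \<noteq> 0" using v(1,2) by (metis carrier_vecD eq_vecI index_zero_vec)
    have "(cmod (v $ i))\<^sup>2 \<le> N" unfolding N_def using i by (intro member_le_sum) auto
    moreover have "(cmod (v $ i))\<^sup>2 > 0" using i by simp
    ultimately show ?thesis by linarith
  qed
  ultimately have "cnj k = k" unfolding S by simp
  then show ?thesis by (metis Reals_cnj_iff)
qed

definition adjacent :: "'a pair_pre_digraph \<Rightarrow> 'a \<Rightarrow> 'a \<Rightarrow> bool" where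
  "adjacent G u v \<longleftrightarrow> (u, v) \<in> parcs G"

text \<open>
  The entries of \<open>I + \<i>xA\<close>, where \<open>A\<close> is the signed adjacency matrix.
\<close>

definition shifted_entry :: "('a \<Rightarrow> 'a \<Rightarrow> bool) \<Rightarrow> ('a set \<Rightarrow> int) \<Rightarrow> real \<Rightarrow> 'a \<Rightarrow> 'a \<Rightarrow> complex" where
  "shifted_entry E \<sigma> x u v =
     (if u = v then 1 else if E u v then \<i> * of_real x * of_int (\<sigma> {u, v}) else 0)"

text \<open>
  The eigenvalues are real because \<open>A\<close> is Hermitian, and
  \<open>det (I + \<i>xA) = (-\<i>x)\<^sup>n det (\<i>/x - A) = \<Prod>(1 + \<i>x\<lambda>)\<close>.
\<close>

lemma energy_spectrum:
  assumes "signed_graph G \<sigma>"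
  obtains L :: "real multiset" where
    "energy G \<sigma> = (\<Sum>a\<in>#L. \<bar>a\<bar>)"
    "\<And>x. x > 0 \<Longrightarrow>
      (cmod (set_det (pverts G) (shifted_entry (adjacent G) \<sigma> x)))\<^sup>2 = (\<Prod>a\<in>#L. 1 + a\<^sup>2 * x\<^sup>2)"
proof -
  interpret signed_graph G \<sigma> by fact
  obtain vs where vs: "set vs = pverts G" "distinct vs"
    using finite_distinct_list[of "pverts G"] by auto
  define n where "n = length vs"
  define A where "A = signed_adj_mat vs G \<sigma>"
  have A: "A \<in> carrier_mat n n" by (simp add: A_def signed_adj_mat_def n_def)
  have Aij: "A $$ (i, j) = (if (vs ! i, vs ! j) \<in> parcs G then of_int (\<sigma> {vs ! i, vs ! j}) else 0)"
    if "i < n" "j < n" for i j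
    using that by (simp add: A_def signed_adj_mat_def n_def)
  have sym: "(u, v) \<in> parcs G \<longleftrightarrow> (v, u) \<in> parcs G" for u v
    using arcs_symmetric by blast
  have irr: "(u, u) \<notin> parcs G" for u
    using pair_no_loops[of "(u, u)"] by auto
  have herm: "A $$ (j, i) = cnj (A $$ (i, j))" if "i < n" "j < n" for i j
    using that sym[of "vs ! i" "vs ! j"] by (simp add: Aij insert_commute)
  obtain as where as: "char_poly A = (\<Prod>a\<leftarrow>as. [:- a, 1:])" "length as = n"
    using char_poly_factorized[OF A] by auto
  have real: "a = of_real (Re a)" if "a \<in> set as" for a
  proof -
    have "poly (char_poly A) a = 0" unfolding as(1) using that
      by (induction as) auto
    then have "eigenvalue A a" using eigenvalue_root_char_poly[OF A] by simp
    from hermitian_eigenvalue_real[OF A herm this] show ?thesis by simp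
  qed
  have "proots (char_poly A) = mset as"
  proof -
    have "proots (\<Prod>a\<leftarrow>xs. [:- a, 1:]) = mset xs" for xs :: "complex list"
    proof (induction xs)
      case (Cons a xs)
      have "(\<Prod>a\<leftarrow>xs. [:- a, 1:]) \<noteq> 0" by (auto simp: prod_list_zero_iff)
      then have "proots ([:- a, 1:] * (\<Prod>a\<leftarrow>xs. [:- a, 1:])) = mset (a # xs)"
      proof -
        assume nz: "(\<Prod>a\<leftarrow>xs. [:- a, 1:]) \<noteq> 0"
        have "proots [:- a, 1:] = {#a#}" using proots_linear_factor[of "- a"] by simp
        then show ?thesis using proots_mult[OF _ nz, of "[:- a, 1:]"] Cons by simp
      qed
      then show ?case by (simp only: list.map prod_list.Cons)
    qed simp
    then show ?thesis unfolding as(1) .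
  qed
  then have e1: "energy G \<sigma> = (\<Sum>a\<leftarrow>as. cmod a)"
    using energy_eqI[OF vs(2,1), of \<sigma>]
    unfolding eigenvalues_def A_def[symmetric] by (simp only: mset_map[symmetric] sum_mset_sum_list)
  have "(\<Sum>a\<leftarrow>as. cmod a) = (\<Sum>a\<leftarrow>as. \<bar>Re a\<bar>)"
  proof (intro arg_cong[of _ _ sum_list] map_cong refl)
    fix a assume "a \<in> set as"
    from real[OF this] have "cmod a = cmod (of_real (Re a))" by (rule arg_cong)
    then show "cmod a = \<bar>Re a\<bar>" by (simp only: norm_of_real)
  qed
  with e1 have "energy G \<sigma> = (\<Sum>a\<in>#mset (map Re as). \<bar>a\<bar>)"
    by (simp only: mset_map[symmetric] sum_mset_sum_list map_map o_def)
  moreover have "(cmod (set_det (pverts G) (shifted_entry (adjacent G) \<sigma> x)))\<^sup>2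
      = (\<Prod>a\<in>#mset (map Re as). 1 + a\<^sup>2 * x\<^sup>2)" if x: "x > 0" for x
  proof -
    \<comment> \<open>The characteristic polynomial is evaluated at the point where \<open>-\<i>x(z - a) = 1
      + \<i>xa\<close>.\<close>
    define z where "z = \<i> / of_real x"
    define B where "B = (- \<i> * of_real x) \<cdot>\<^sub>m (- char_matrix A z)"
    have z: "\<i> * of_real x * z = -1" using x by (simp add: z_def)
    have cm: "- char_matrix A z \<in> carrier_mat n n" using A by simp
    have B: "B \<in> carrier_mat n n" unfolding B_def using A by simp
    have Bij: "B $$ (i, j) = shifted_entry (adjacent G) \<sigma> x (vs ! i) (vs ! j)" if ij: "i < n" "j < n" for i j
    proof -
      have "B $$ (i, j) = \<i> * of_real x * (A $$ (i, j) - z * (if i = j then 1 else 0))"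
        unfolding B_def using A ij by (simp add: char_matrix_def algebra_simps)
      moreover have "vs ! i = vs ! j \<longleftrightarrow> i = j" using vs(2) ij by (simp add: n_def nth_eq_iff_index_eq)
      ultimately show ?thesis using ij z irr by (simp add: Aij shifted_entry_def adjacent_def)
    qed
    have "bij_betw (\<lambda>i. vs ! i) {0..<n} (pverts G)"
      using bij_betw_nth[OF vs(2), of "{0..<n}" "pverts G"] vs(1) by (simp add: n_def atLeast0LessThan)
    then have "set_det (pverts G) (shifted_entry (adjacent G) \<sigma> x)
       = set_det {0..<n} (\<lambda>i j. shifted_entry (adjacent G) \<sigma> x (vs ! i) (vs ! j))"
      by (rule set_det_reindex) simp
    also have "\<dots> = det B"
      unfolding det_eq_set_det[OF B] by (rule set_det_cong) (simp add: Bij)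
    also have "\<dots> = (- \<i> * of_real x) ^ n * poly (char_poly A) z"
      unfolding B_def det_smult char_poly_matrix[OF A] using cm by simp
    also have "\<dots> = (\<Prod>a\<leftarrow>as. 1 + \<i> * of_real (x * Re a))"
    proof -
      have "(- \<i> * of_real x) ^ length as * poly (\<Prod>a\<leftarrow>as. [:- a, 1:]) z
          = (\<Prod>a\<leftarrow>as. 1 + \<i> * of_real (x * Re a))"
        using real
      proof (induction as)
        case (Cons a as)
        have "(- \<i> * of_real x) * (z - a) = 1 + \<i> * of_real (x * Re a)"
        proof -
          have "(- \<i> * of_real x) * (z - a) = - (\<i> * of_real x * z) + \<i> * (of_real x * a)"
            by (simp add: algebra_simps)
          also have "\<dots> = 1 + \<i> * (of_real x * of_real (Re a))"
            using z Cons.prems[of a] by simp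
          finally show ?thesis by simp
        qed
        moreover have "(- \<i> * of_real x) ^ length (a # as) * poly (\<Prod>a\<leftarrow>a # as. [:- a, 1:]) z
          = ((- \<i> * of_real x) * (z - a)) * ((- \<i> * of_real x) ^ length as * poly (\<Prod>a\<leftarrow>as. [:- a, 1:]) z)"
        proof -
          have "poly (\<Prod>a\<leftarrow>a # as. [:- a, 1:]) z = (z - a) * poly (\<Prod>a\<leftarrow>as. [:- a, 1:]) z"
            by (simp add: algebra_simps)
          then show ?thesis by (simp only: list.size power_Suc mult.assoc mult.left_commute add_0_right add_Suc_right)
        qed
        ultimately show ?case using Cons by (simp only: list.map prod_list.Cons list.set_intros)
      qed simp
      then show ?thesis by (simp add: as)
    qed
    also have "(cmod \<dots>)\<^sup>2 = (\<Prod>a\<leftarrow>as. 1 + (Re a)\<^sup>2 * x\<^sup>2)"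
      by (induction as) (simp_all add: norm_mult power_mult_distrib cmod_power2 mult.commute)
    finally show ?thesis by (simp only: mset_map[symmetric] prod_mset_prod_list map_map o_def)
  qed
  ultimately show ?thesis by (rule that)
qed

section \<open>Graphs with at most one cycle\<close>

definition nbrs :: "('a \<Rightarrow> 'a \<Rightarrow> bool) \<Rightarrow> 'a set \<Rightarrow> 'a \<Rightarrow> 'a set" where
  "nbrs E V v = {u \<in> V. E v u}"

text \<open>
  Cycles are given by their vertices in cyclic order.  In contrast to walks in a digraph this
  excludes walking back along the same edge, and adjacency may be any relation, so that vertices
  and edges are easy to delete.
\<close>

definition cycle_list :: "('a \<Rightarrow> 'a \<Rightarrow> bool) \<Rightarrow> 'a list \<Rightarrow> bool" where
  "cycle_list E vs \<longleftrightarrow> distinct vs \<and> 3 \<le> length vs \<and>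
     (\<forall>i<length vs. E (vs ! i) (vs ! (Suc i mod length vs)))"

definition cycle_edges :: "'a list \<Rightarrow> 'a set set" where
  "cycle_edges vs = (\<lambda>i. {vs ! i, vs ! (Suc i mod length vs)}) ` {..<length vs}"

definition acyclic_on :: "('a \<Rightarrow> 'a \<Rightarrow> bool) \<Rightarrow> 'a set \<Rightarrow> bool" where
  "acyclic_on E V \<longleftrightarrow> (\<nexists>vs. cycle_list E vs \<and> set vs \<subseteq> V)"

definition only_cycle :: "('a \<Rightarrow> 'a \<Rightarrow> bool) \<Rightarrow> 'a set \<Rightarrow> 'a list \<Rightarrow> bool" where
  "only_cycle E V vs \<longleftrightarrow> cycle_list E vs \<and> set vs \<subseteq> V \<and>
     (\<forall>ws. cycle_list E ws \<and> set ws \<subseteq> V \<longrightarrow> cycle_edges ws = cycle_edges vs)"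

lemma Union_cycle_edges: "\<Union> (cycle_edges vs) = set vs"
proof
  show "\<Union> (cycle_edges vs) \<subseteq> set vs"
    by (auto simp: cycle_edges_def) (metis gr_implies_not0 mod_less_divisor neq0_conv nth_mem)
  show "set vs \<subseteq> \<Union> (cycle_edges vs)"
    by (auto simp: cycle_edges_def in_set_conv_nth)
qed

text \<open>
  The first vertex of a longest path has all its neighbours on the path; one of them is not the
  second vertex and closes a cycle.
\<close>

lemma min_degree_2_cycle:
  assumes fin: "finite V" and ne: "V \<noteq> {}" and sym: "symp E" and irr: "irreflp E"
    and deg: "\<And>v. v \<in> V \<Longrightarrow> 2 \<le> card (nbrs E V v)"
  shows "\<exists>vs. cycle_list E vs \<and> set vs \<subseteq> V"
proof -
  define P where "P p \<longleftrightarrow> p \<noteq> [] \<and> distinct p \<and> set p \<subseteq> V \<and>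
    (\<forall>i. Suc i < length p \<longrightarrow> E (p ! i) (p ! Suc i))" for p
  obtain v where "v \<in> V" using ne by blast
  then have "P [v]" by (simp add: P_def)
  moreover have "length p < Suc (card V)" if "P p" for p
    using that fin unfolding P_def by (metis card_mono distinct_card less_Suc_eq_le)
  ultimately obtain p where p: "P p" and max: "\<And>q. P q \<Longrightarrow> length q \<le> length p"
    using ex_has_greatest_nat[of P "[v]" length "Suc (card V)"] by (metis less_or_eq_imp_le)
  define a where "a = hd p"
  have a: "a = p ! 0" "a \<in> V" "p \<noteq> []" using p by (auto simp: P_def a_def hd_conv_nth)
  have sub: "w \<in> set p" if "w \<in> nbrs E V a" for w
  proof (rule ccontr)
    assume w: "w \<notin> set p"
    have "P (w # p)" unfolding P_def
    proof (intro conjI allI impI)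
      fix i assume i: "Suc i < length (w # p)"
      show "E ((w # p) ! i) ((w # p) ! Suc i)"
      proof (cases i)
        case 0
        then show ?thesis using that a sympD[OF sym, of a w] by (auto simp: nbrs_def)
      next
        case (Suc j)
        then show ?thesis using i p by (simp add: P_def)
      qed
    qed (use p w that in \<open>auto simp: P_def nbrs_def\<close>)
    from max[OF this] show False by simp
  qed
  have "\<not> nbrs E V a \<subseteq> {p ! 1}"
  proof
    assume "nbrs E V a \<subseteq> {p ! 1}"
    from card_mono[OF _ this] deg[OF a(2)] show False by simp
  qed
  then obtain w where w: "w \<in> nbrs E V a" "w \<noteq> p ! 1" by auto
  then obtain k where k: "k < length p" "p ! k = w" using sub in_set_conv_nth by metis
  have "w \<noteq> a" using w irr by (auto simp: nbrs_def irreflp_def)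
  then have "k \<noteq> 0" using k(2) a(1) by metis
  moreover have "k \<noteq> 1" using k(2) w(2) by metis
  ultimately have k2: "k \<ge> 2" by linarith
  let ?c = "take (Suc k) p"
  have len: "length ?c = Suc k" using k by simp
  have "E (?c ! i) (?c ! (Suc i mod length ?c))" if "i < length ?c" for i
  proof (cases "i = k")
    case True
    then show ?thesis using w k sympD[OF sym, of a w] a len by (auto simp: nbrs_def)
  next
    case False
    then show ?thesis using that p k len by (auto simp: P_def)
  qed
  then have "cycle_list E ?c" unfolding cycle_list_def using len k2 p by (auto simp: P_def)
  moreover have "set ?c \<subseteq> V" using p set_take_subset[of "Suc k" p] by (auto simp: P_def)
  ultimately show ?thesis by blast
qed

lemma acyclic_low_degree:
  assumes "finite V" "V \<noteq> {}" "symp E" "irreflp E" "acyclic_on E V"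
  obtains v where "v \<in> V" "card (nbrs E V v) \<le> 1"
  using min_degree_2_cycle[OF assms(1-4)] assms(5) unfolding acyclic_on_def
  by (metis Suc_1 not_less_eq_eq)

lemma acyclic_on_subset: "acyclic_on E V \<Longrightarrow> W \<subseteq> V \<Longrightarrow> acyclic_on E W"
  unfolding acyclic_on_def by blast

lemma sum_degrees_remove:
  assumes fin: "finite V" and v: "v \<in> V" and "symp E" "irreflp E"
  shows "(\<Sum>u\<in>V. card (nbrs E V u)) = (\<Sum>u\<in>V - {v}. card (nbrs E (V - {v}) u)) + 2 * card (nbrs E V v)"
proof -
  have "card (nbrs E V u) = card (nbrs E (V - {v}) u) + (if E v u then 1 else 0)" if "u \<in> V - {v}" for u
  proof -
    have "nbrs E V u = nbrs E (V - {v}) u \<union> (if E v u then {v} else {})"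
      using v sympD[OF assms(3), of u v] sympD[OF assms(3), of v u] by (auto simp: nbrs_def)
    moreover have "finite (nbrs E (V - {v}) u)" "v \<notin> nbrs E (V - {v}) u" using fin by (auto simp: nbrs_def)
    ultimately show ?thesis by simp
  qed
  then have "(\<Sum>u\<in>V - {v}. card (nbrs E V u))
     = (\<Sum>u\<in>V - {v}. card (nbrs E (V - {v}) u)) + (\<Sum>u\<in>V - {v}. if E v u then 1 else 0)"
    by (simp add: sum.distrib)
  also have "(\<Sum>u\<in>V - {v}. if E v u then 1 else 0) = card (nbrs E V v)"
  proof -
    have "nbrs E V v = {u \<in> V - {v}. E v u}" using assms(4) by (auto simp: nbrs_def irreflp_def)
    then show ?thesis using fin by (simp add: sum.If_cases Int_def)
  qed
  finally show ?thesis using sum.remove[OF fin v, of "\<lambda>u. card (nbrs E V u)"] by simp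
qed

lemma acyclic_sum_degrees:
  assumes "finite V" "V \<noteq> {}" "symp E" "irreflp E" "acyclic_on E V"
  shows "(\<Sum>u\<in>V. card (nbrs E V u)) + 2 \<le> 2 * card V"
  using assms(1,2,5)
proof (induction "card V" arbitrary: V)
  case (Suc n)
  obtain v where v: "v \<in> V" "card (nbrs E V v) \<le> 1"
    using acyclic_low_degree[OF Suc.prems(1,2) assms(3,4) Suc.prems(3)] by blast
  note eq = sum_degrees_remove[OF Suc.prems(1) v(1) assms(3,4)]
  have c: "card (V - {v}) = n" "card V = Suc n" using Suc v by auto
  show ?case
  proof (cases "V - {v} = {}")
    case True
    then have "V = {v}" using v by auto
    then have "nbrs E V v = {}" using assms(4) by (auto simp: nbrs_def irreflp_def)
    then show ?thesis using eq True c by simp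
  next
    case False
    then have "(\<Sum>u\<in>V - {v}. card (nbrs E (V - {v}) u)) + 2 \<le> 2 * card (V - {v})"
      using Suc c acyclic_on_subset[of E V "V - {v}"] by (intro Suc.hyps(1)) auto
    then show ?thesis using eq v c by simp
  qed
qed auto

text \<open>
  Removing an edge of the cycle leaves a forest, which has fewer edges than vertices.
\<close>

lemma only_cycle_sum_degrees:
  assumes fin: "finite V" and sym: "symp E" and irr: "irreflp E" and only: "only_cycle E V vs"
  shows "(\<Sum>u\<in>V. card (nbrs E V u)) \<le> 2 * card V"
proof -
  have vs: "cycle_list E vs" "set vs \<subseteq> V" using only unfolding only_cycle_def by blast+
  define a b where "a = vs ! 0" and "b = vs ! 1"
  have len: "3 \<le> length vs" "distinct vs" using vs by (auto simp: cycle_list_def)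
  have ab: "a \<in> V" "b \<in> V" "a \<noteq> b"
  proof -
    have "a \<in> set vs" "b \<in> set vs" using len by (auto simp: a_def b_def intro!: nth_mem)
    then show "a \<in> V" "b \<in> V" using vs by auto
    have "0 < length vs" "1 < length vs" using len by linarith+
    then show "a \<noteq> b" unfolding a_def b_def using nth_eq_iff_index_eq[OF len(2)] by (metis zero_neq_one)
  qed
  have edge: "{a, b} \<in> cycle_edges vs"
    using len by (auto simp: cycle_edges_def a_def b_def intro!: image_eqI[of _ _ 0])
  \<comment> \<open>Delete the cycle edge between the first two vertices of the list.\<close>
  define E' where "E' u v \<longleftrightarrow> E u v \<and> {u, v} \<noteq> {a, b}" for u v
  have "acyclic_on E' V" unfolding acyclic_on_def
  proof
    assume "\<exists>ws. cycle_list E' ws \<and> set ws \<subseteq> V"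
    then obtain ws where ws: "cycle_list E' ws" "set ws \<subseteq> V" by blast
    then have "cycle_list E ws" by (auto simp: cycle_list_def E'_def)
    then have "cycle_edges ws = cycle_edges vs" using only ws unfolding only_cycle_def by blast
    then have "{a, b} \<in> cycle_edges ws" using edge by simp
    then show False using ws(1) by (auto simp: cycle_edges_def cycle_list_def E'_def)
  qed
  moreover have "symp E'" using sym by (auto simp: E'_def symp_def insert_commute)
  moreover have "irreflp E'" using irr by (auto simp: E'_def irreflp_def)
  ultimately have le: "(\<Sum>u\<in>V. card (nbrs E' V u)) + 2 \<le> 2 * card V"
    using acyclic_sum_degrees[OF fin] ab by blast
  have "card (nbrs E V u) \<le> card (nbrs E' V u) + (if u \<in> {a, b} then 1 else 0)" if "u \<in> V" for u
  proof -
    have "nbrs E V u \<subseteq> nbrs E' V u \<union> (if u = a then {b} else if u = b then {a} else {})"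
      by (auto simp: nbrs_def E'_def doubleton_eq_iff)
    then have "card (nbrs E V u) \<le> card (nbrs E' V u \<union> (if u = a then {b} else if u = b then {a} else {}))"
      using fin by (intro card_mono) (auto simp: nbrs_def)
    also have "\<dots> \<le> card (nbrs E' V u) + card (if u = a then {b} else if u = b then {a} else {})"
      by (rule card_Un_le)
    finally show ?thesis by (auto split: if_splits)
  qed
  then have "(\<Sum>u\<in>V. card (nbrs E V u)) \<le> (\<Sum>u\<in>V. card (nbrs E' V u) + (if u \<in> {a, b} then 1 else 0))"
    by (rule sum_mono)
  also have "\<dots> = (\<Sum>u\<in>V. card (nbrs E' V u)) + card {a, b}"
  proof -
    have "V \<inter> {a, b} = {a, b}" using ab by auto
    then show ?thesis using fin by (simp add: sum.distrib sum.If_cases del: insert_iff)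
  qed
  finally show ?thesis using le ab by simp
qed

lemma cycle_list_nbrs:
  assumes vs: "cycle_list E vs" "set vs \<subseteq> V" and sym: "symp E" and i: "i < length vs"
  shows "{vs ! (Suc i mod length vs), vs ! ((i + length vs - 1) mod length vs)} \<subseteq> nbrs E V (vs ! i)"
    and "card {vs ! (Suc i mod length vs), vs ! ((i + length vs - 1) mod length vs)} = 2"
proof -
  let ?l = "length vs"
  let ?j = "Suc i mod ?l" and ?k = "(i + ?l - 1) mod ?l"
  have len: "3 \<le> ?l" "distinct vs" using vs by (auto simp: cycle_list_def)
  have k_eq: "?k = (if i = 0 then ?l - 1 else i - 1)"
  proof (cases "i = 0")
    case True
    then show ?thesis using i by simp
  next
    case False
    then have "i + ?l - 1 = (i - 1) + ?l" by simp
    then show ?thesis using i False by (simp only: mod_add_self2 if_False) (rule mod_less, linarith)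
  qed
  have j_eq: "?j = (if Suc i = ?l then 0 else Suc i)" using i by auto
  have k: "?k < ?l" "Suc ?k mod ?l = i" "?j < ?l" unfolding k_eq j_eq using i len(1) by auto
  have "?j \<noteq> ?k" unfolding k_eq j_eq using i len(1) by auto
  then show "card {vs ! ?j, vs ! ?k} = 2" using len k by (simp add: nth_eq_iff_index_eq)
  have "E (vs ! i) (vs ! ?j)" using vs(1) i by (simp add: cycle_list_def)
  moreover have "E (vs ! ?k) (vs ! (Suc ?k mod ?l))" using vs(1) k(1) unfolding cycle_list_def by blast
  then have "E (vs ! i) (vs ! ?k)" using sympD[OF sym] k(2) by simp
  moreover have "vs ! ?j \<in> V" "vs ! ?k \<in> V" using k(1,3) vs(2) nth_mem by blast+
  ultimately show "{vs ! ?j, vs ! ?k} \<subseteq> nbrs E V (vs ! i)" by (simp add: nbrs_def)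
qed

lemma cycle_vertex_degree:
  assumes "cycle_list E vs" "set vs \<subseteq> V" "symp E" "finite V" "v \<in> set vs"
  shows "2 \<le> card (nbrs E V v)"
proof -
  obtain i where i: "i < length vs" "v = vs ! i" using assms(5) by (metis in_set_conv_nth)
  have "finite (nbrs E V v)" using assms(4) by (simp add: nbrs_def)
  from card_mono[OF this] show ?thesis
    using cycle_list_nbrs[OF assms(1-3) i(1)] i(2) by metis
qed

lemma only_cycle_subset:
  "only_cycle E V vs \<Longrightarrow> W \<subseteq> V \<Longrightarrow> set vs \<subseteq> W \<Longrightarrow> only_cycle E W vs"
  unfolding only_cycle_def by blast

lemma only_cycle_acyclic:
  assumes "only_cycle E V vs" "W \<subseteq> V" "u \<in> set vs" "u \<notin> W"
  shows "acyclic_on E W"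
  unfolding acyclic_on_def
proof
  assume "\<exists>ws. cycle_list E ws \<and> set ws \<subseteq> W"
  then obtain ws where ws: "cycle_list E ws" "set ws \<subseteq> W" by blast
  then have "cycle_edges ws = cycle_edges vs" using assms unfolding only_cycle_def by blast
  then have "set ws = set vs" by (metis Union_cycle_edges)
  then show False using ws assms by blast
qed

text \<open>
  By the bound on the sum of the degrees, every degree is exactly two.  No edge leaves the cycle
  then, and vertices outside of it would carry a second cycle.
\<close>

lemma only_cycle_min_degree_2:
  assumes fin: "finite V" and sym: "symp E" and irr: "irreflp E" and only: "only_cycle E V vs"
    and deg: "\<And>v. v \<in> V \<Longrightarrow> 2 \<le> card (nbrs E V v)"
  shows "V = set vs"
    and "\<And>i j. i < length vs \<Longrightarrow> j < length vs \<Longrightarrow>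
       E (vs ! i) (vs ! j) \<longleftrightarrow> j = Suc i mod length vs \<or> i = Suc j mod length vs"
proof -
  let ?l = "length vs"
  have vs: "cycle_list E vs" "set vs \<subseteq> V" using only unfolding only_cycle_def by blast+
  have len: "3 \<le> ?l" "distinct vs" using vs by (auto simp: cycle_list_def)
  have finN: "finite (nbrs E V v)" for v using fin by (simp add: nbrs_def)
  have deg2: "card (nbrs E V v) = 2" if "v \<in> V" for v
  proof (rule ccontr)
    assume "card (nbrs E V v) \<noteq> 2"
    then have "2 < card (nbrs E V v)" using deg[OF that] by simp
    then have "(\<Sum>u\<in>V. 2) < (\<Sum>u\<in>V. card (nbrs E V u))"
      using fin that deg by (intro sum_strict_mono_ex1) auto
    then show False using only_cycle_sum_degrees[OF fin sym irr only] by simp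
  qed
  have nb: "nbrs E V (vs ! i) = {vs ! (Suc i mod ?l), vs ! ((i + ?l - 1) mod ?l)}" if i: "i < ?l" for i
  proof -
    have "card (nbrs E V (vs ! i)) = 2" using vs(2) i by (intro deg2) (metis nth_mem subsetD)
    then show ?thesis
      using card_subset_eq[OF finN cycle_list_nbrs(1)[OF vs(1,2) sym i]] cycle_list_nbrs(2)[OF vs(1,2) sym i]
      by argo
  qed
  have closed: "w \<in> set vs" if v: "v \<in> set vs" and w: "w \<in> nbrs E V v" for v w
  proof -
    obtain i where i: "i < ?l" "v = vs ! i" using v by (metis in_set_conv_nth)
    have "w \<in> {vs ! (Suc i mod ?l), vs ! ((i + ?l - 1) mod ?l)}" using nb[OF i(1)] i(2) w by simp
    moreover have "k mod ?l < ?l" for k using len(1) by (intro mod_less_divisor) linarith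
    ultimately show ?thesis by (metis empty_iff insert_iff nth_mem)
  qed
  show V: "V = set vs"
  proof (rule ccontr)
    assume "V \<noteq> set vs"
    then have ne: "V - set vs \<noteq> {}" using vs by auto
    have "2 \<le> card (nbrs E (V - set vs) w)" if w: "w \<in> V - set vs" for w
    proof -
      have "nbrs E V w \<subseteq> nbrs E (V - set vs) w"
      proof
        fix u assume u: "u \<in> nbrs E V w"
        then have "w \<in> nbrs E V u" using w sympD[OF sym, of w u] by (auto simp: nbrs_def)
        then have "u \<notin> set vs" using closed[of u w] w by auto
        then show "u \<in> nbrs E (V - set vs) w" using u by (simp add: nbrs_def)
      qed
      then have "card (nbrs E V w) \<le> card (nbrs E (V - set vs) w)"
        using fin by (intro card_mono) (auto simp: nbrs_def)
      then show ?thesis using deg[of w] w by simp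
    qed
    then obtain ws where ws: "cycle_list E ws" "set ws \<subseteq> V - set vs"
      using min_degree_2_cycle[OF _ ne sym irr] fin by blast
    then have "cycle_edges ws = cycle_edges vs" using only ws unfolding only_cycle_def by blast
    then have "set ws = set vs" by (metis Union_cycle_edges)
    then show False using ws len by (cases vs) auto
  qed
  show "E (vs ! i) (vs ! j) \<longleftrightarrow> j = Suc i mod ?l \<or> i = Suc j mod ?l" if ij: "i < ?l" "j < ?l" for i j
  proof -
    have "E (vs ! i) (vs ! j) \<longleftrightarrow> vs ! j \<in> nbrs E V (vs ! i)" using ij V by (simp add: nbrs_def)
    also have "\<dots> \<longleftrightarrow> j = Suc i mod ?l \<or> j = (i + ?l - 1) mod ?l"
    proof -
      have "k mod ?l < ?l" for k using len(1) by (intro mod_less_divisor) linarith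
      then show ?thesis unfolding nb[OF ij(1)] using nth_eq_iff_index_eq[OF len(2) ij(2)] by simp
    qed
    also have "j = (i + ?l - 1) mod ?l \<longleftrightarrow> i = Suc j mod ?l"
    proof (cases "i = 0")
      case True
      then show ?thesis using ij by (auto simp: mod_Suc)
    next
      case False
      then have "i + ?l - 1 = (i - 1) + ?l" by simp
      then have "(i + ?l - 1) mod ?l = i - 1" using ij by (simp only: mod_add_self2) (rule mod_less, linarith)
      then show ?thesis using ij False by (auto simp: mod_Suc)
    qed
    finally show ?thesis .
  qed
qed

section \<open>Determinants of acyclic and unicyclic signed graphs\<close>

lemma tadpole_poly_Suc_mono: "t \<ge> 0 \<Longrightarrow> tadpole_poly l m t \<le> tadpole_poly l (Suc m) t"
  unfolding tadpole_poly_def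
  using path_poly_Suc_mono[of t "l + m"] path_poly_Suc_mono[of t m] path_poly_nonneg[of t "l - 2"]
  by (auto intro!: add_mono mult_left_mono)

lemma tadpole_poly_rec:
  "tadpole_poly l (Suc (Suc m)) t = tadpole_poly l (Suc m) t + t * tadpole_poly l m t"
  unfolding tadpole_poly_def by (simp add: algebra_simps)

text \<open>
  This covers the deletion of a pendant vertex and of its neighbour on the cycle, which leaves a
  forest.
\<close>

lemma tadpole_poly_cycle_vertex:
  assumes "t \<ge> 0" "l + m = Suc k"
  shows "tadpole_poly l m t + t * path_poly k t \<le> tadpole_poly l (Suc m) t"
proof -
  have "path_poly (l + Suc m) t = path_poly (l + m) t + t * path_poly k t"
    using assms(2) by simp
  moreover have "t * path_poly (l - 2) t * path_poly m t \<le> t * path_poly (l - 2) t * path_poly (Suc m) t"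
    using assms(1) path_poly_nonneg[OF assms(1)] path_poly_Suc_mono[OF assms(1)]
    by (intro mult_left_mono) auto
  ultimately show ?thesis unfolding tadpole_poly_def by simp
qed

locale signed_adjacency =
  fixes E :: "'a \<Rightarrow> 'a \<Rightarrow> bool" and \<sigma> :: "'a set \<Rightarrow> int" and x :: real
  assumes sym: "symp E" and irr: "irreflp E"
    and sgn: "\<And>u v. E u v \<Longrightarrow> \<sigma> {u, v} \<in> {1, -1}"
begin

abbreviation "f \<equiv> shifted_entry E \<sigma> x"
abbreviation "t \<equiv> x\<^sup>2"

lemma entry_mult: "E u v \<Longrightarrow> f u v * f v u = - of_real t"
proof -
  assume uv: "E u v"
  then have "E v u" "u \<noteq> v" using sym irr by (auto dest: sympD simp: irreflp_def)
  moreover have "of_int (\<sigma> {u, v}) * of_int (\<sigma> {u, v}) = (1 :: complex)" using sgn[OF uv] by auto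
  ultimately show ?thesis using uv
    by (simp add: shifted_entry_def insert_commute[of v] power2_eq_square algebra_simps)
qed

text \<open>
  The two off-diagonal entries of an edge multiply to \<open>(\<i>x)\<^sup>2 = -t\<close> for either sign of the edge, so
  the sign of a pendant edge disappears and the weight \<open>t\<close> is nonnegative.
\<close>

lemma low_degree_reduction:
  assumes fin: "finite V" and v: "v \<in> V" "card (nbrs E V v) \<le> 1"
  obtains (isolated) "set_det V f = set_det (V - {v}) f"
  | (pendant) u where "u \<in> V" "u \<noteq> v"
      "set_det V f = set_det (V - {v}) f + of_real t * set_det (V - {u, v}) f"
proof -
  have finN: "finite (nbrs E V v)" using fin by (simp add: nbrs_def)
  have vv: "f v v = 1" by (simp add: shifted_entry_def)
  consider "nbrs E V v = {}" | u where "nbrs E V v = {u}"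
    using v(2) finN by (metis One_nat_def card_0_eq card_1_singletonE le_Suc_eq le_zero_eq)
  then show ?thesis
  proof cases
    case 1
    have "set_det V f = set_det (V - {v}) f"
    proof (rule set_det_isolated[where f = f, OF fin v(1) vv])
      show "f v w = 0" if "w \<in> V" "w \<noteq> v" for w using that 1 by (auto simp: nbrs_def shifted_entry_def)
    qed
    then show ?thesis by (rule isolated)
  next
    case (2 u)
    then have u: "u \<in> V" "E v u" by (auto simp: nbrs_def)
    then have ne: "u \<noteq> v" using irr by (auto simp: irreflp_def)
    have nE: "\<not> E v w" "\<not> E w v" if "w \<in> V" "w \<noteq> u" for w
    proof -
      show "\<not> E v w" using that 2 by (auto simp: nbrs_def)
      then show "\<not> E w v" using sympD[OF sym] by blast
    qed
    have "set_det V f = set_det (V - {v}) f - f v u * f u v * set_det (V - {u, v}) f"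
      by (rule set_det_pendant[where f = f, OF fin v(1) u(1) ne vv]) (auto simp: shifted_entry_def nE)
    then show ?thesis using entry_mult[OF u(2)] by (intro pendant[OF u(1) ne]) simp
  qed
qed

lemma det_acyclic:
  assumes "finite V" "acyclic_on E V"
  shows "\<exists>a. set_det V f = of_real a \<and> 1 \<le> a \<and> a \<le> path_poly (card V) t"
  using assms
proof (induction "card V" arbitrary: V rule: less_induct)
  case less
  show ?case
  proof (cases "V = {}")
    case True
    then show ?thesis by (intro exI[of _ 1]) simp
  next
    case False
    obtain v where v: "v \<in> V" "card (nbrs E V v) \<le> 1"
      using acyclic_low_degree[OF less.prems(1) False sym irr less.prems(2)] by blast
    have c1: "card V = Suc (card (V - {v}))" using less.prems(1) v(1) by (metis card_Suc_Diff1)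
    have "acyclic_on E (V - {v})" by (rule acyclic_on_subset[OF less.prems(2)]) auto
    then obtain a where a: "set_det (V - {v}) f = of_real a" "1 \<le> a" "a \<le> path_poly (card (V - {v})) t"
      using less.hyps[of "V - {v}"] less.prems(1) c1 by auto
    show ?thesis
    proof (cases rule: low_degree_reduction[OF less.prems(1) v])
      case 1
      then show ?thesis using a path_poly_Suc_mono[of t "card (V - {v})"] c1 by (intro exI[of _ a]) simp
    next
      case (2 u)
      have c2: "card (V - {v}) = Suc (card (V - {u, v}))"
      proof -
        have "V - {u, v} = V - {v} - {u}" by auto
        then show ?thesis using less.prems(1) 2(1,2) by (metis card_Suc_Diff1 finite_Diff DiffI singletonD)
      qed
      have "acyclic_on E (V - {u, v})" by (rule acyclic_on_subset[OF less.prems(2)]) auto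
      then obtain b where b: "set_det (V - {u, v}) f = of_real b" "1 \<le> b" "b \<le> path_poly (card (V - {u, v})) t"
        using less.hyps[of "V - {u, v}"] less.prems(1) c1 c2 by auto
      have "set_det V f = of_real (a + t * b)" using 2(3) a b by simp
      moreover have "1 \<le> a + t * b" using a b by (simp add: add_increasing2)
      moreover have "a + t * b \<le> path_poly (card V) t"
        using a(3) mult_left_mono[OF b(3), of t] unfolding c1 c2 by simp
      ultimately show ?thesis by blast
    qed
  qed
qed

text \<open>
  Twice the sign of the cycle times the sign of a rotation as a permutation.
\<close>

definition cycle_coeff :: "'a list \<Rightarrow> int" where
  "cycle_coeff vs = 2 * ((- 1) ^ (length vs - 1) * (\<Prod>i<length vs. \<sigma> {vs ! i, vs ! (Suc i mod length vs)}))"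

lemma abs_cycle_coeff:
  assumes "cycle_list E vs"
  shows "\<bar>cycle_coeff vs\<bar> = 2"
proof -
  have "\<bar>\<sigma> {vs ! i, vs ! (Suc i mod length vs)}\<bar> = 1" if "i < length vs" for i
  proof -
    have "E (vs ! i) (vs ! (Suc i mod length vs))" using assms that by (simp add: cycle_list_def)
    from sgn[OF this] show ?thesis by auto
  qed
  then show ?thesis unfolding cycle_coeff_def by (simp add: abs_mult abs_prod power_abs)
qed

lemma det_cycle:
  assumes vs: "distinct vs" "length vs \<ge> 3"
    and adj: "\<And>i j. i < length vs \<Longrightarrow> j < length vs \<Longrightarrow>
       E (vs ! i) (vs ! j) \<longleftrightarrow> j = Suc i mod length vs \<or> i = Suc j mod length vs"
  shows "set_det (set vs) f = of_real (tadpole_poly (length vs) 0 t)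
    + of_int (cycle_coeff vs) * (\<i> * of_real x) ^ length vs"
proof -
  let ?l = "length vs"
  define g where "g i j = f (vs ! i) (vs ! j)" for i j
  have bij: "bij_betw (\<lambda>i. vs ! i) {0..<?l} (set vs)"
    using bij_betw_nth[OF vs(1), of "{0..<?l}" "set vs"] by (simp add: atLeast0LessThan)
  have m: "k mod ?l < ?l" for k using vs(2) by (intro mod_less_divisor) linarith
  have e: "E (vs ! i) (vs ! (Suc i mod ?l))" if "i < ?l" for i using adj[OF that m] by simp
  have ent: "f u v = \<i> * of_real x * of_int (\<sigma> {u, v})" "f v u = \<i> * of_real x * of_int (\<sigma> {u, v})"
    if "E u v" for u v
    using that sympD[OF sym that] irr by (auto simp: shifted_entry_def irreflp_def insert_commute)
  have "set_det (set vs) f = set_det {0..<?l} g"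
    unfolding g_def by (rule set_det_reindex[OF bij]) simp
  also have "\<dots> = of_real (tadpole_poly ?l 0 t)
      + (- 1) ^ (?l - 1) * ((\<Prod>i<?l. g i (Suc i mod ?l)) + (\<Prod>i<?l. g (Suc i mod ?l) i))"
  proof (rule set_det_cycle[OF vs(2)])
    show "g i i = 1" for i by (simp add: g_def shifted_entry_def)
    show "g i j = 0" if "i < ?l" "j < ?l" "i \<noteq> j" "j \<noteq> Suc i mod ?l" "i \<noteq> Suc j mod ?l" for i j
      using that adj[of i j] vs(1) by (simp add: g_def shifted_entry_def nth_eq_iff_index_eq)
    show "g i (Suc i mod ?l) * g (Suc i mod ?l) i = - of_real t" if "i < ?l" for i
      unfolding g_def by (rule entry_mult[OF e[OF that]])
  qed
  also have "(\<Prod>i<?l. g i (Suc i mod ?l)) = (\<i> * of_real x) ^ ?l * of_int (\<Prod>i<?l. \<sigma> {vs ! i, vs ! (Suc i mod ?l)})"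
  proof -
    have "(\<Prod>i<?l. g i (Suc i mod ?l)) = (\<Prod>i<?l. \<i> * of_real x * of_int (\<sigma> {vs ! i, vs ! (Suc i mod ?l)}))"
      unfolding g_def using ent(1)[OF e] by (intro prod.cong refl) simp
    then show ?thesis by (simp add: prod.distrib power_mult_distrib)
  qed
  also have "(\<Prod>i<?l. g (Suc i mod ?l) i) = (\<i> * of_real x) ^ ?l * of_int (\<Prod>i<?l. \<sigma> {vs ! i, vs ! (Suc i mod ?l)})"
  proof -
    have "(\<Prod>i<?l. g (Suc i mod ?l) i) = (\<Prod>i<?l. \<i> * of_real x * of_int (\<sigma> {vs ! i, vs ! (Suc i mod ?l)}))"
      unfolding g_def using ent(2)[OF e] by (intro prod.cong refl) simp
    then show ?thesis by (simp add: prod.distrib power_mult_distrib)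
  qed
  finally show ?thesis unfolding cycle_coeff_def by (simp add: algebra_simps)
qed

text \<open>
  Induction on the number \<open>m\<close> of vertices outside the cycle.  A vertex of degree at most one lies
  outside the cycle; deleting it, or it and its neighbour, gives a graph with the same cycle or a
  forest.  Without such a vertex the graph is the cycle.  The coefficient depends on the cycle only,
  so the contributions of both deletions add up.
\<close>

lemma det_only_cycle:
  assumes "finite V" "only_cycle E V vs" "card V = length vs + m"
  shows "\<exists>a b.
     set_det V f = of_real a + of_int (cycle_coeff vs) * (\<i> * of_real x) ^ length vs * of_real b \<and>
     1 \<le> a \<and> a \<le> tadpole_poly (length vs) m t \<and> 0 \<le> b \<and> b \<le> path_poly m t"
  using assms
proof (induction m arbitrary: V rule: less_induct)
  case (less m)
  let ?l = "length vs" and ?z = "(\<i> * of_real x) ^ length vs"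
  note fin = less.prems(1) and only = less.prems(2) and card = less.prems(3)
  have vs: "cycle_list E vs" "set vs \<subseteq> V" using only unfolding only_cycle_def by blast+
  have len: "3 \<le> ?l" "distinct vs" using vs(1) by (auto simp: cycle_list_def)
  have cvs: "card (set vs) = ?l" using len by (simp add: distinct_card)
  show ?case
  proof (cases "\<exists>v\<in>V. card (nbrs E V v) \<le> 1")
    case False
    then have deg: "\<And>v. v \<in> V \<Longrightarrow> 2 \<le> card (nbrs E V v)" by (metis Suc_1 not_less_eq_eq)
    note cyc = only_cycle_min_degree_2[OF fin sym irr only deg]
    have m: "m = 0" using cyc(1) card cvs by simp
    have "set_det V f = of_real (tadpole_poly ?l 0 t) + of_int (cycle_coeff vs) * ?z * of_real 1"
      using det_cycle[OF len(2,1) cyc(2)] arg_cong[OF cyc(1), of "\<lambda>V. set_det V f"] by simp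
    then show ?thesis using m tadpole_poly_ge_1[of t ?l 0]
      by (intro exI[of _ "tadpole_poly ?l 0 t"] exI[of _ 1]) simp
  next
    case True
    then obtain v where v: "v \<in> V" "card (nbrs E V v) \<le> 1" by blast
    have "v \<notin> set vs" using cycle_vertex_degree[OF vs sym fin, of v] v(2) by auto
    then have sub: "set vs \<subseteq> V - {v}" using vs(2) by auto
    have c1: "card V = Suc (card (V - {v}))" using fin v(1) by (metis card_Suc_Diff1)
    have "?l \<le> card (V - {v})" using card_mono[OF _ sub] fin cvs by simp
    then obtain k where m: "m = Suc k" using c1 card by (cases m) auto
    then have ck: "card (V - {v}) = ?l + k" using c1 card by simp
    have o1: "only_cycle E (V - {v}) vs" by (rule only_cycle_subset[OF only _ sub]) auto
    obtain a b where ab: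
      "set_det (V - {v}) f = of_real a + of_int (cycle_coeff vs) * ?z * of_real b"
      "1 \<le> a" "a \<le> tadpole_poly ?l k t" "0 \<le> b" "b \<le> path_poly k t"
      using less.IH[of k "V - {v}"] fin o1 ck m by blast
    show ?thesis
    proof (cases rule: low_degree_reduction[OF fin v])
      case 1
      then show ?thesis
        using ab tadpole_poly_Suc_mono[of t ?l k] path_poly_Suc_mono[of t k] m
        by (intro exI[of _ a] exI[of _ b]) auto
    next
      case (2 u)
      have c2: "card (V - {v}) = Suc (card (V - {u, v}))"
      proof -
        have "V - {u, v} = V - {v} - {u}" by auto
        then show ?thesis using fin 2(1,2) by (metis card_Suc_Diff1 finite_Diff DiffI singletonD)
      qed
      show ?thesis
      proof (cases "u \<in> set vs")
        case True
        have "acyclic_on E (V - {u, v})" by (rule only_cycle_acyclic[OF only _ True]) auto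
        then obtain c where c: "set_det (V - {u, v}) f = of_real c" "1 \<le> c"
          "c \<le> path_poly (card (V - {u, v})) t"
          using det_acyclic[of "V - {u, v}"] fin by auto
        have "set_det V f = of_real (a + t * c) + of_int (cycle_coeff vs) * ?z * of_real b"
          using 2(3) ab(1) c(1) by simp
        moreover have "1 \<le> a + t * c" using ab c by (simp add: add_increasing2)
        moreover have "a + t * c \<le> tadpole_poly ?l m t"
          using ab(3) mult_left_mono[OF c(3), of t]
            tadpole_poly_cycle_vertex[of t ?l k "card (V - {u, v})"] ck c2 m by simp
        moreover have "b \<le> path_poly m t" using ab(5) path_poly_Suc_mono[of t k] m by simp
        ultimately show ?thesis using ab(4) by blast
      next
        case False
        then have sub2: "set vs \<subseteq> V - {u, v}" using sub by auto
        have "?l \<le> card (V - {u, v})" using card_mono[OF _ sub2] fin cvs by simp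
        then obtain j where k: "k = Suc j" using c2 ck by (cases k) auto
        then have cj: "card (V - {u, v}) = ?l + j" using c2 ck by simp
        have o2: "only_cycle E (V - {u, v}) vs" by (rule only_cycle_subset[OF only _ sub2]) auto
        obtain a' b' where ab': 
          "set_det (V - {u, v}) f = of_real a' + of_int (cycle_coeff vs) * ?z * of_real b'"
          "1 \<le> a'" "a' \<le> tadpole_poly ?l j t" "0 \<le> b'" "b' \<le> path_poly j t"
          using less.IH[of j "V - {u, v}"] fin o2 cj m k by auto
        have "set_det V f = of_real (a + t * a') + of_int (cycle_coeff vs) * ?z * of_real (b + t * b')"
          using 2(3) ab(1) ab'(1) by (simp add: algebra_simps)
        moreover have "1 \<le> a + t * a'" using ab(2) ab'(2) by (simp add: add_increasing2)
        moreover have "a + t * a' \<le> tadpole_poly ?l m t"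
          using ab(3) mult_left_mono[OF ab'(3), of t] m k tadpole_poly_rec[of ?l j t] by simp
        moreover have "0 \<le> b + t * b'" using ab(4) ab'(4) by simp
        moreover have "b + t * b' \<le> path_poly m t"
          using ab(5) mult_left_mono[OF ab'(5), of t] m k by simp
        ultimately show ?thesis by blast
      qed
    qed
  qed
qed

end

section \<open>From digraph cycles to lists of vertices\<close>

context signed_adjacency
begin

lemma cmod_even_le:
  assumes "\<bar>c\<bar> = 2" "0 \<le> a" "0 \<le> b" "0 < x" "even l"
  shows "cmod (of_real a + of_int c * (\<i> * of_real x) ^ l * of_real b) \<le> a + 2 * t ^ (l div 2) * b"
proof -
  have "x ^ l = t ^ (l div 2)" using assms(5) by (simp flip: power_mult)
  then have "cmod (of_int c * (\<i> * of_real x) ^ l * of_real b) = 2 * t ^ (l div 2) * b"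
    using assms by (simp add: norm_mult norm_power norm_of_int flip: of_int_abs)
  then show ?thesis using assms norm_triangle_ineq[of "of_real a"] by (metis abs_of_nonneg norm_of_real)
qed

text \<open>
  For odd \<open>l\<close> the cycle term is purely imaginary.
\<close>

lemma cmod_odd:
  assumes "\<bar>c\<bar> = 2" "odd l"
  shows "(cmod (of_real a + of_int c * (\<i> * of_real x) ^ l * of_real b))\<^sup>2 = a\<^sup>2 + 4 * t ^ l * b\<^sup>2"
proof -
  obtain k where l: "l = 2 * k + 1" using assms(2) by (elim oddE)
  have "(\<i> * of_real x) ^ l = \<i> * of_real x * of_real ((- t) ^ k)"
    unfolding l by (simp add: power_mult power_mult_distrib)
  then have "of_real a + of_int c * (\<i> * of_real x) ^ l * of_real b
     = Complex a (of_int c * x * (- t) ^ k * b)"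
    by (simp add: complex_eq_iff)
  moreover have "(of_int c * x * (- t) ^ k * b)\<^sup>2 = (of_int c)\<^sup>2 * (t * ((- t) ^ k)\<^sup>2) * b\<^sup>2"
    by (simp only: power_mult_distrib mult_ac)
  moreover have "(of_int c)\<^sup>2 = (4 :: real)"
  proof -
    have "c = 2 \<or> c = -2" using assms(1) by linarith
    then show ?thesis by auto
  qed
  moreover have "y * ((- y) ^ k)\<^sup>2 = y ^ l" for y :: real
  proof -
    have "((- y) ^ k)\<^sup>2 = ((- y)\<^sup>2) ^ k" by (metis power_mult mult.commute)
    also have "\<dots> = y ^ (2 * k)" by (simp only: power2_minus power_mult)
    finally show ?thesis unfolding l by simp
  qed
  ultimately show ?thesis by (simp only: cmod_power2 complex.sel)
qed

end

lemma awalk_verts_cas: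
  "pre_digraph.cas (with_proj G) u p v \<Longrightarrow> pre_digraph.awalk_verts (with_proj G) u p = u # map snd p"
  by (induction p arbitrary: u) (auto simp: pre_digraph.cas.simps pre_digraph.awalk_verts.simps)

lemma cas_iff_nth:
  "p \<noteq> [] \<Longrightarrow> pre_digraph.cas (with_proj G) u p v \<longleftrightarrow>
     fst (p ! 0) = u \<and> snd (p ! (length p - 1)) = v \<and> (\<forall>i. Suc i < length p \<longrightarrow> snd (p ! i) = fst (p ! Suc i))"
proof (induction p arbitrary: u)
  case (Cons e p)
  show ?case
  proof (cases "p = []")
    case True
    then show ?thesis by (auto simp: pre_digraph.cas.simps)
  next
    case False
    have "(\<forall>i. Suc i < length (e # p) \<longrightarrow> snd ((e # p) ! i) = fst ((e # p) ! Suc i)) \<longleftrightarrow>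
      snd e = fst (p ! 0) \<and> (\<forall>i. Suc i < length p \<longrightarrow> snd (p ! i) = fst (p ! Suc i))"
      (is "?L \<longleftrightarrow> ?R")
    proof
      assume L: ?L
      then have "snd e = fst (p ! 0)" using False by (auto dest: spec[of _ 0])
      moreover have "snd (p ! i) = fst (p ! Suc i)" if "Suc i < length p" for i
        using L[rule_format, of "Suc i"] that by simp
      ultimately show ?R by blast
    next
      assume R: ?R
      show ?L
      proof (intro allI impI)
        fix i assume "Suc i < length (e # p)"
        then show "snd ((e # p) ! i) = fst ((e # p) ! Suc i)" using R by (cases i) auto
      qed
    qed
    moreover have "snd ((e # p) ! (length (e # p) - 1)) = snd (p ! (length p - 1))"
      using False by (simp add: nth_Cons')
    ultimately show ?thesis
      using Cons.IH[OF False, of "snd e"] by (auto simp: pre_digraph.cas.simps)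
  qed
qed simp

text \<open>
  This lemma and the next one match the cycles of the digraph of length at least three with lists of
  vertices, up to the choice of a starting point and a direction, which the sets of edges forget.
\<close>

lemma cycle_list_awalk:
  fixes G :: "'a pair_pre_digraph"
  assumes "pair_graph G" and vs: "cycle_list (adjacent G) vs"
  shows "cycle_edge_set G (cycle_edges vs) \<and> set vs \<subseteq> pverts G"
proof -
  interpret pair_graph G by fact
  let ?l = "length vs"
  have len: "3 \<le> ?l" "distinct vs" using vs by (auto simp: cycle_list_def)
  have mod: "k mod ?l < ?l" for k using len(1) by (intro mod_less_divisor) linarith
  have arc: "(vs ! i, vs ! (Suc i mod ?l)) \<in> parcs G" if "i < ?l" for i
    using vs that by (simp add: cycle_list_def adjacent_def)
  have sub: "set vs \<subseteq> pverts G"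
    using in_arcsD1[OF arc] by (auto simp: in_set_conv_nth)
  define p where "p = map (\<lambda>i. (vs ! i, vs ! (Suc i mod ?l))) [0..<?l]"
  have p: "length p = ?l" "\<And>i. i < ?l \<Longrightarrow> p ! i = (vs ! i, vs ! (Suc i mod ?l))"
    by (simp_all add: p_def)
  have ne: "p \<noteq> []" using len p(1) by auto
  have cas: "pre_digraph.cas (with_proj G) (vs ! 0) p (vs ! 0)"
  proof -
    have l0: "0 < ?l" "?l - 1 < ?l" "Suc (?l - 1) = ?l" using len(1) by linarith+
    have "fst (p ! 0) = vs ! 0" "snd (p ! (length p - 1)) = vs ! 0"
      using p(2)[OF l0(1)] p(2)[OF l0(2)] l0(3) p(1) by simp_all
    moreover have "snd (p ! i) = fst (p ! Suc i)" if "Suc i < length p" for i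
      using that p(1) p(2)[of i] p(2)[of "Suc i"] by simp
    ultimately show ?thesis unfolding cas_iff_nth[OF ne] by blast
  qed
  have "distinct (map snd p)"
  proof -
    have "map snd p = rotate1 vs"
      using p by (intro nth_equalityI) (simp_all add: nth_rotate1)
    then show ?thesis using len(2) by simp
  qed
  then have "pre_digraph.cycle (with_proj G) p"
    unfolding pre_digraph.cycle_def pre_digraph.awalk_def
    using cas ne awalk_verts_cas[OF cas] arc sub len(1)
    by (intro exI[of _ "vs ! 0"]) (auto simp: p_def)
  moreover have "(\<lambda>(u, v). {u, v}) ` set p = cycle_edges vs"
    unfolding p_def cycle_edges_def by (auto simp: image_image atLeast0LessThan)
  ultimately have "cycle_edge_set G (cycle_edges vs)"
    unfolding cycle_edge_set_def using p(1) len(1) by metis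
  with sub show ?thesis by blast
qed

lemma cycle_edge_set_list:
  fixes G :: "'a pair_pre_digraph"
  assumes "cycle_edge_set G C"
  obtains vs where "cycle_list (adjacent G) vs" "C = cycle_edges vs"
proof -
  obtain p u where p: "set p \<subseteq> parcs G" "pre_digraph.cas (with_proj G) u p u"
    "distinct (tl (pre_digraph.awalk_verts (with_proj G) u p))" "3 \<le> length p"
    and C: "C = (\<lambda>(u, v). {u, v}) ` set p"
    using assms unfolding cycle_edge_set_def pre_digraph.cycle_def pre_digraph.awalk_def by auto
  let ?l = "length p"
  define vs where "vs = map fst p"
  have ne: "p \<noteq> []" using p(4) by auto
  have dist: "distinct (map snd p)" using p(3) awalk_verts_cas[OF p(2)] by simp
  have nxt: "snd (p ! i) = fst (p ! (Suc i mod ?l))" if "i < ?l" for i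
  proof (cases "Suc i = ?l")
    case True
    then have "i = ?l - 1" by simp
    then show ?thesis using p(2) True unfolding cas_iff_nth[OF ne] by simp
  next
    case False
    then show ?thesis using p(2) that unfolding cas_iff_nth[OF ne] by simp
  qed
  have mod: "k mod ?l < ?l" for k using p(4) by (intro mod_less_divisor) linarith
  have "map snd p = rotate1 vs"
    using nxt mod by (intro nth_equalityI) (simp_all add: vs_def nth_rotate1)
  then have "distinct vs" using dist by simp
  moreover have arc: "(vs ! i, vs ! (Suc i mod ?l)) = p ! i" if "i < ?l" for i
    using nxt[OF that] that mod[of "Suc i"] by (simp add: vs_def prod_eq_iff)
  then have "adjacent G (vs ! i) (vs ! (Suc i mod ?l))" if "i < ?l" for i
  proof -
    have "p ! i \<in> parcs G" using that p(1) nth_mem by blast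
    then show ?thesis unfolding adjacent_def arc[OF that] .
  qed
  ultimately have "cycle_list (adjacent G) vs"
    using p(4) unfolding cycle_list_def by (simp add: vs_def)
  moreover have "C = cycle_edges vs"
  proof -
    have "C = (\<lambda>i. (\<lambda>(u, v). {u, v}) (p ! i)) ` {..<?l}"
    proof -
      have "set p = (\<lambda>i. p ! i) ` {..<?l}" by (auto simp: set_conv_nth)
      then show ?thesis unfolding C by (simp only: image_image)
    qed
    also have "\<dots> = cycle_edges vs"
      unfolding cycle_edges_def
    proof (rule image_cong)
      show "{..<?l} = {..<length vs}" by (simp add: vs_def)
      fix i assume "i \<in> {..<length vs}"
      then have "i < ?l" by (simp add: vs_def)
      from arc[OF this, symmetric]
      show "(\<lambda>(u, v). {u, v}) (p ! i) = {vs ! i, vs ! (Suc i mod length vs)}" by (simp add: vs_def)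
    qed
    finally show ?thesis .
  qed
  ultimately show ?thesis by (rule that)
qed

lemma connected_unicyclic_only_cycle:
  assumes "pair_graph G" "connected_unicyclic G"
  obtains vs where "only_cycle (adjacent G) (pverts G) vs"
proof -
  obtain C where C: "cycle_edge_set G C" "\<And>D. cycle_edge_set G D \<Longrightarrow> D = C"
    using assms(2) unfolding connected_unicyclic_def by blast
  obtain vs where vs: "cycle_list (adjacent G) vs" "C = cycle_edges vs"
    using cycle_edge_set_list[OF C(1)] by blast
  have "only_cycle (adjacent G) (pverts G) vs"
    unfolding only_cycle_def using vs C(2) cycle_list_awalk[OF assms(1)] by blast
  then show ?thesis by (rule that)
qed

lemma signed_graph_adjacency:
  assumes "signed_graph G \<sigma>"
  shows "signed_adjacency (adjacent G) \<sigma>"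
proof -
  interpret signed_graph G \<sigma> by fact
  show ?thesis
  proof
    show "symp (adjacent G)" using arcs_symmetric by (auto simp: symp_def adjacent_def)
    show "irreflp (adjacent G)" using pair_no_loops by (force simp: irreflp_def adjacent_def)
    show "\<And>u v. adjacent G u v \<Longrightarrow> \<sigma> {u, v} \<in> {1, -1}" using sign_values by (simp add: adjacent_def)
  qed
qed

text \<open>
  The squared modulus of \<open>det (I + \<i>xA)\<close>, that is, the product of \<open>1 + \<lambda>\<^sup>2x\<^sup>2\<close> over the spectrum.
\<close>

definition char_sq :: "'a pair_pre_digraph \<Rightarrow> ('a set \<Rightarrow> int) \<Rightarrow> real \<Rightarrow> real" where
  "char_sq G \<sigma> x = (cmod (set_det (pverts G) (shifted_entry (adjacent G) \<sigma> x)))\<^sup>2"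

lemma unicyclic_char_sq_le:
  assumes G: "signed_graph G \<sigma>" "connected_unicyclic G" and card: "card (pverts G) = n"
  obtains l m where "3 \<le> l" "l + m = n"
    "\<And>x. 0 < x \<Longrightarrow> even l \<Longrightarrow>
       char_sq G \<sigma> x \<le> (tadpole_poly l m (x\<^sup>2) + 2 * (x\<^sup>2) ^ (l div 2) * path_poly m (x\<^sup>2))\<^sup>2"
    "\<And>x. 0 < x \<Longrightarrow> odd l \<Longrightarrow>
       char_sq G \<sigma> x \<le> (tadpole_poly l m (x\<^sup>2))\<^sup>2 + 4 * (x\<^sup>2) ^ l * (path_poly m (x\<^sup>2))\<^sup>2"
proof -
  interpret signed_graph G \<sigma> by fact
  have pg: "pair_graph G" by unfold_locales
  obtain vs where vs: "only_cycle (adjacent G) (pverts G) vs"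
    using connected_unicyclic_only_cycle[OF pg G(2)] by blast
  then have cl: "cycle_list (adjacent G) vs" "set vs \<subseteq> pverts G" unfolding only_cycle_def by blast+
  then have len: "3 \<le> length vs" "distinct vs" by (auto simp: cycle_list_def)
  have "length vs \<le> n"
    using card_mono[OF pair_finite_verts cl(2)] len card by (simp add: distinct_card)
  then obtain m where m: "length vs + m = n" using le_Suc_ex by metis
  have bounds: "\<exists>a b c. \<bar>c :: int\<bar> = 2 \<and> char_sq G \<sigma> x =
      (cmod (of_real a + of_int c * (\<i> * of_real x) ^ length vs * of_real b))\<^sup>2 \<and>
      1 \<le> a \<and> a \<le> tadpole_poly (length vs) m (x\<^sup>2) \<and> 0 \<le> b \<and> b \<le> path_poly m (x\<^sup>2)" for x
  proof -
    interpret A: signed_adjacency "adjacent G" \<sigma> x by (rule signed_graph_adjacency[OF G(1)])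
    show ?thesis
      using A.det_only_cycle[OF pair_finite_verts vs] A.abs_cycle_coeff[OF cl(1)] m card
      unfolding char_sq_def by metis
  qed
  show ?thesis
  proof (rule that[OF len(1) m])
    fix x :: real assume x: "0 < x" and ev: "even (length vs)"
    interpret A: signed_adjacency "adjacent G" \<sigma> x by (rule signed_graph_adjacency[OF G(1)])
    obtain a b c where abc: "\<bar>c :: int\<bar> = 2" "char_sq G \<sigma> x =
      (cmod (of_real a + of_int c * (\<i> * of_real x) ^ length vs * of_real b))\<^sup>2"
      "1 \<le> a" "a \<le> tadpole_poly (length vs) m (x\<^sup>2)" "0 \<le> b" "b \<le> path_poly m (x\<^sup>2)"
      using bounds by blast
    have "cmod (of_real a + of_int c * (\<i> * of_real x) ^ length vs * of_real b)
       \<le> a + 2 * (x\<^sup>2) ^ (length vs div 2) * b"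
      using A.cmod_even_le[OF abc(1) _ abc(5) x ev, of a] abc(3) by simp
    also have "\<dots> \<le> tadpole_poly (length vs) m (x\<^sup>2) + 2 * (x\<^sup>2) ^ (length vs div 2) * path_poly m (x\<^sup>2)"
      using abc(4,6) by (intro add_mono mult_left_mono) auto
    finally show "char_sq G \<sigma> x \<le>
        (tadpole_poly (length vs) m (x\<^sup>2) + 2 * (x\<^sup>2) ^ (length vs div 2) * path_poly m (x\<^sup>2))\<^sup>2"
      unfolding abc(2) by (intro power_mono) auto
  next
    fix x :: real assume x: "0 < x" and od: "odd (length vs)"
    interpret A: signed_adjacency "adjacent G" \<sigma> x by (rule signed_graph_adjacency[OF G(1)])
    obtain a b c where abc: "\<bar>c :: int\<bar> = 2" "char_sq G \<sigma> x =
      (cmod (of_real a + of_int c * (\<i> * of_real x) ^ length vs * of_real b))\<^sup>2"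
      "1 \<le> a" "a \<le> tadpole_poly (length vs) m (x\<^sup>2)" "0 \<le> b" "b \<le> path_poly m (x\<^sup>2)"
      using bounds by blast
    have "char_sq G \<sigma> x = a\<^sup>2 + 4 * (x\<^sup>2) ^ length vs * b\<^sup>2"
      unfolding abc(2) by (rule A.cmod_odd[OF abc(1) od])
    also have "\<dots> \<le> (tadpole_poly (length vs) m (x\<^sup>2))\<^sup>2 + 4 * (x\<^sup>2) ^ length vs * (path_poly m (x\<^sup>2))\<^sup>2"
      using abc(3-6) by (intro add_mono mult_left_mono power_mono) auto
    finally show "char_sq G \<sigma> x \<le>
      (tadpole_poly (length vs) m (x\<^sup>2))\<^sup>2 + 4 * (x\<^sup>2) ^ length vs * (path_poly m (x\<^sup>2))\<^sup>2" .
  qed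
qed

section \<open>The two extremal graphs\<close>

lemma char_sq_odd_cycle:
  assumes n: "odd n" "3 \<le> n"
  shows "char_sq (cycle_graph n) cycle_pos_sign x = (1 + 4 * x\<^sup>2) * (path_poly (n - 1) (x\<^sup>2))\<^sup>2"
proof -
  let ?E = "adjacent (cycle_graph n)"
  have G: "signed_graph (cycle_graph n) cycle_pos_sign" using n by (intro signed_graph_cycle_graph) simp
  interpret A: signed_adjacency ?E cycle_pos_sign x by (rule signed_graph_adjacency[OF G])
  let ?vs = "[0..<n]"
  have adj: "?E (?vs ! i) (?vs ! j) \<longleftrightarrow> j = Suc i mod length ?vs \<or> i = Suc j mod length ?vs"
    if "i < length ?vs" "j < length ?vs" for i j
    using that by (auto simp: adjacent_def cycle_graph_def)
  have "\<bar>A.cycle_coeff ?vs\<bar> = 2"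
    by (simp add: A.cycle_coeff_def cycle_pos_sign_def abs_mult power_abs)
  moreover have "set_det (pverts (cycle_graph n)) A.f = of_real (tadpole_poly n 0 (x\<^sup>2))
     + of_int (A.cycle_coeff ?vs) * (\<i> * of_real x) ^ n * of_real 1"
    using A.det_cycle[of ?vs] adj n by (simp add: cycle_graph_def atLeast0LessThan)
  ultimately have "char_sq (cycle_graph n) cycle_pos_sign x
     = (tadpole_poly n 0 (x\<^sup>2))\<^sup>2 + 4 * (x\<^sup>2) ^ n * 1\<^sup>2"
    unfolding char_sq_def using A.cmod_odd[OF _ n(1)] by presburger
  then show ?thesis using odd_cycle_poly[OF n, of "x\<^sup>2"] by simp
qed

text \<open>
  The adjacency of \<open>P4_graph n\<close> for all \<open>n\<close> at once; the order enters only through the vertex set.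
\<close>

definition P4_adj :: "nat \<Rightarrow> nat \<Rightarrow> bool" where
  "P4_adj i j \<longleftrightarrow> j = Suc i \<or> i = Suc j \<or> (i = 0 \<and> j = 3) \<or> (i = 3 \<and> j = 0)"

lemma P4_poly_rec:
  "P4_poly 0 t = tadpole_poly 4 0 t + 2 * t\<^sup>2"
  "P4_poly (Suc 0) t = P4_poly 0 t + t * path_poly 3 t"
  "P4_poly (Suc (Suc j)) t = P4_poly (Suc j) t + t * P4_poly j t"
  unfolding P4_poly_eq tadpole_poly_4
  by (simp_all add: path_poly_values algebra_simps power2_eq_square)

text \<open>
  Deleting the last vertex of the path, and the last two, gives the recursion of \<open>P4_poly\<close>.  It
  starts with the negative 4-cycle, where the sign of the cycle and the sign of the rotation cancel.
\<close>

lemma set_det_P4: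
  "set_det {0..<4 + j} (shifted_entry P4_adj P4_sign x) = of_real (P4_poly j (x\<^sup>2))"
proof -
  interpret A: signed_adjacency P4_adj P4_sign x
    by unfold_locales (auto simp: symp_def irreflp_def P4_adj_def P4_sign_def)
  have base: "set_det {0..<4} A.f = of_real (P4_poly 0 (x\<^sup>2))"
  proof -
    let ?vs = "[0..<4]"
    have adj: "P4_adj (?vs ! i) (?vs ! j) \<longleftrightarrow> j = Suc i mod length ?vs \<or> i = Suc j mod length ?vs"
      if "i < length ?vs" "j < length ?vs" for i j
    proof -
      have "i < 4" "j < 4" using that by simp_all
      then have "P4_adj i j \<longleftrightarrow> j = Suc i mod 4 \<or> i = Suc j mod 4"
      proof -
        have m: "Suc k mod 4 = (if k = 3 then 0 else Suc k)" if "k < 4" for k :: nat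
          using that by (simp add: mod_Suc)
        show ?thesis
          unfolding P4_adj_def m[OF \<open>i < 4\<close>] m[OF \<open>j < 4\<close>] using \<open>i < 4\<close> \<open>j < 4\<close> by (cases "i = 3"; cases "j = 3") auto
      qed
      then show ?thesis using \<open>i < 4\<close> \<open>j < 4\<close> by simp
    qed
    have "A.cycle_coeff ?vs = 2"
    proof -
      have "{..<4 :: nat} = {0, 1, 2, 3}" by auto
      then show ?thesis by (simp add: A.cycle_coeff_def P4_sign_def doubleton_eq_iff)
    qed
    moreover have "(\<i> * of_real x) ^ 4 = of_real ((x\<^sup>2)\<^sup>2)"
      by (simp add: power_mult_distrib flip: power_mult)
    ultimately show ?thesis
      using A.det_cycle[of ?vs] adj unfolding P4_poly_rec(1) by simp
  qed
  have step: "set_det {0..<4 + Suc i} A.f = set_det {0..<4 + i} A.f + of_real (x\<^sup>2) * set_det {0..<3 + i} A.f" for i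
  proof -
    let ?V = "{0..<4 + Suc i}" and ?v = "4 + i" and ?u = "3 + i"
    have "set_det ?V A.f = set_det (?V - {?v}) A.f - A.f ?v ?u * A.f ?u ?v * set_det (?V - {?u, ?v}) A.f"
      by (rule set_det_pendant[where f = A.f]) (auto simp: shifted_entry_def P4_adj_def)
    moreover have "A.f ?v ?u * A.f ?u ?v = - of_real (x\<^sup>2)"
      by (rule A.entry_mult) (simp add: P4_adj_def)
    moreover have "?V - {?v} = {0..<4 + i}" "?V - {?u, ?v} = {0..<3 + i}" by auto
    ultimately show ?thesis by simp
  qed
  have path: "set_det {0..<0 + 3} A.f = of_real (path_poly 3 (x\<^sup>2))"
  proof (rule set_det_path)
    show "A.f i i = 1" for i by (simp add: shifted_entry_def)
    show "A.f i j = 0 \<and> A.f j i = 0" if "i \<in> {0..<0 + 3}" "j \<in> {0..<0 + 3}" "Suc i < j" for i j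
      using that by (auto simp: shifted_entry_def P4_adj_def)
    show "A.f i (Suc i) * A.f (Suc i) i = - of_real (x\<^sup>2)" for i
      by (rule A.entry_mult) (simp add: P4_adj_def)
  qed
  show ?thesis
  proof (induction j rule: less_induct)
    case (less j)
    consider "j = 0" | "j = Suc 0" | i where "j = Suc (Suc i)" by (metis not0_implies_Suc)
    then show ?case
    proof cases
      case 1
      then show ?thesis using base by simp
    next
      case 2
      then show ?thesis using step[of 0] base path P4_poly_rec(2) by simp
    next
      case (3 i)
      have "3 + Suc i = 4 + i" by simp
      then show ?thesis
        using step[of "Suc i"] less[of i] less[of "Suc i"] 3 by (simp add: P4_poly_rec(3))
    qed
  qed
qed

lemma char_sq_P4:
  "char_sq (P4_graph (4 + j)) P4_sign x = (P4_poly j (x\<^sup>2))\<^sup>2"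
proof -
  let ?G = "P4_graph (4 + j)"
  have V: "pverts ?G = {0..<4 + j}" by (auto simp: P4_graph_def)
  have adj: "adjacent ?G u v \<longleftrightarrow> P4_adj u v" if "u \<in> {0..<4 + j}" "v \<in> {0..<4 + j}" for u v
    using that by (auto simp: P4_graph_def adjacent_def P4_adj_def)
  have "set_det {0..<4 + j} (shifted_entry (adjacent ?G) P4_sign x)
      = set_det {0..<4 + j} (shifted_entry P4_adj P4_sign x)"
    by (rule set_det_cong) (simp only: shifted_entry_def adj)
  then show ?thesis unfolding char_sq_def V set_det_P4 by simp
qed

section \<open>Rational bounds for small orders\<close>

text \<open>
  The function \<open>char_sq\<close> of a hypothetical graph with spectrum \<open>L\<close>, in the variable \<open>t = x\<^sup>2\<close>.
\<close>

definition spec_prod :: "real multiset \<Rightarrow> real \<Rightarrow> real" where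
  "spec_prod L t = (\<Prod>a\<in>#L. 1 + a\<^sup>2 * t)"

lemma spec_prod_simps [simp]:
  "spec_prod {#} t = 1"
  "spec_prod (add_mset a L) t = (1 + a\<^sup>2 * t) * spec_prod L t"
  "spec_prod (K + L) t = spec_prod K t * spec_prod L t"
  by (simp_all add: spec_prod_def)

lemma path_poly_horner:
  "path_poly 5 t = poly [:1, 4, 3:] t"
  "path_poly 6 t = poly [:1, 5, 6, 1:] t"
  "path_poly 8 t = poly [:1, 7, 15, 10, 1:] t"
  by (simp_all add: path_poly_values algebra_simps numeral_eq_Suc)

lemma poly_pCons_mono:
  fixes a b t :: real
  shows "a \<le> b \<Longrightarrow> poly p t \<le> poly q t \<Longrightarrow> 0 \<le> t \<Longrightarrow> poly (pCons a p) t \<le> poly (pCons b q) t"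
  by (simp add: add_mono mult_left_mono)

text \<open>
  The majorant is not itself a product of real linear factors.  The numbers on the right were
  found by minimizing their sum subject to the coefficientwise inequality, and rounded; their sum
  \<open>11.55\<close> has to stay below the energy \<open>11.591\<dots>\<close> of \<open>P4_graph 9\<close>.
\<close>

lemma odd_majorant_5_le:
  assumes "0 \<le> t"
  shows "odd_majorant 5 t \<le> spec_prod {#4/20, 13/20, 22/20, 23/20, 25/20, 29/20, 30/20, 39/20, 46/20#} t"
proof -
  have "odd_majorant 5 t = poly (([:1, 2:] * [:1, 5, 6, 1:] + [:0, 2, 2:] * [:1, 4, 3:])\<^sup>2
      + [:0, 0, 0, 4:] * [:1, 5, 6, 1:]\<^sup>2) t"
  proof -
    have h: "1 + 2 * t = poly [:1, 2:] t" "2 * t + 2 * t\<^sup>2 = poly [:0, 2, 2:] t"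
      "4 * t ^ 3 = poly [:0, 0, 0, 4:] t"
      by (simp_all add: algebra_simps numeral_eq_Suc)
    have Suc_5_eq_6: "Suc 5 = 6" by simp
    show ?thesis
      unfolding odd_majorant_def tadpole_poly_4
      by (simp only: h path_poly_horner Suc_5_eq_6 poly_mult poly_add poly_power)
  qed
  also have "\<dots> = poly [:1, 18, 133, 526, 1218, 1696, 1393, 616, 112, 4:] t"
    by (rule arg_cong[of _ _ "\<lambda>p. poly p t"]) (simp add: power2_eq_square)
  also have "\<dots> \<le> poly ([:1, (4/20)\<^sup>2:] * [:1, (13/20)\<^sup>2:] * [:1, (22/20)\<^sup>2:] * [:1, (23/20)\<^sup>2:] *
      [:1, (25/20)\<^sup>2:] * [:1, (29/20)\<^sup>2:] * [:1, (30/20)\<^sup>2:] * [:1, (39/20)\<^sup>2:] * [:1, (46/20)\<^sup>2:]) t"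
    using assms by (simp add: power2_eq_square del: poly_pCons poly_mult) (intro poly_pCons_mono order_refl; simp)
  also have "\<dots> = spec_prod {#4/20, 13/20, 22/20, 23/20, 25/20, 29/20, 30/20, 39/20, 46/20#} t"
    by (simp only: poly_mult poly_pCons poly_0 spec_prod_simps mult_zero_right add_0_right mult_1_right mult.assoc mult.commute[of t])
  finally show ?thesis .
qed

text \<open>
  The numbers on the right are the absolute values of the eigenvalues of the cycle on nine vertices,
  rounded up; all but the eigenvalue \<open>2\<close> are double.
\<close>

lemma odd_cycle_9_le:
  assumes "0 \<le> t"
  shows "(1 + 4 * t) * (path_poly 8 t)\<^sup>2
    \<le> spec_prod {#2, 35/100, 35/100, 1, 1, 154/100, 154/100, 188/100, 188/100#} t"
proof -
  have "path_poly 8 t = poly [:1, 7, 15, 10, 1:] t" by (rule path_poly_horner(3))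
  also have "\<dots> \<le> poly ([:1, (35/100)\<^sup>2:] * [:1, 1\<^sup>2:] * [:1, (154/100)\<^sup>2:] * [:1, (188/100)\<^sup>2:]) t"
    using assms by (simp add: power2_eq_square del: poly_pCons poly_mult) (intro poly_pCons_mono order_refl; simp)
  also have "\<dots> = spec_prod {#35/100, 1, 154/100, 188/100#} t"
    by (simp only: poly_mult poly_pCons poly_0 spec_prod_simps mult_zero_right add_0_right mult_1_right mult.assoc mult.commute[of t])
  finally have "(1 + 4 * t) * (path_poly 8 t)\<^sup>2 \<le> (1 + 4 * t) * (spec_prod {#35/100, 1, 154/100, 188/100#} t)\<^sup>2"
    using assms path_poly_nonneg[OF assms, of 8] by (intro mult_left_mono power_mono) auto
  also have "\<dots> = spec_prod {#2, 35/100, 35/100, 1, 1, 154/100, 154/100, 188/100, 188/100#} t"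
    by (simp add: power2_eq_square)
  finally show ?thesis .
qed

text \<open>
  The remaining bounds replace the exact eigenvalues by rational numbers, rounded in the direction
  in which each inequality is used, and compare coefficients.
\<close>

lemma P4_poly_1_le:
  assumes "0 \<le> t"
  shows "P4_poly 1 t \<le> spec_prod {#142/100, 174/100#} t"
proof -
  have h: "P4_poly 1 t = poly [:1, 5, 6:] t"
    by (simp add: P4_poly_def path_poly_values algebra_simps numeral_eq_Suc)
  have s: "poly ([:1, (142/100)\<^sup>2:] * [:1, (174/100)\<^sup>2:]) t = spec_prod {#142/100, 174/100#} t"
    by (simp only: poly_mult poly_pCons poly_0 spec_prod_simps mult_zero_right add_0_right mult_1_right mult.assoc mult.commute[of t])
  have "poly [:1, 5, 6:] t \<le> poly ([:1, (142/100)\<^sup>2:] * [:1, (174/100)\<^sup>2:]) t"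
    using assms by (simp add: power2_eq_square del: poly_pCons poly_mult) (intro poly_pCons_mono order_refl; simp)
  then show ?thesis unfolding h s .
qed

lemma path_poly_4_ge:
  assumes "0 \<le> t"
  shows "spec_prod {#16/10, 6/10#} t \<le> path_poly 4 t"
proof -
  have h: "path_poly 4 t = poly [:1, 3, 1:] t"
    by (simp add: P4_poly_def path_poly_values algebra_simps numeral_eq_Suc)
  have s: "poly ([:1, (16/10)\<^sup>2:] * [:1, (6/10)\<^sup>2:]) t = spec_prod {#16/10, 6/10#} t"
    by (simp only: poly_mult poly_pCons poly_0 spec_prod_simps mult_zero_right add_0_right mult_1_right mult.assoc mult.commute[of t])
  have "poly ([:1, (16/10)\<^sup>2:] * [:1, (6/10)\<^sup>2:]) t \<le> poly [:1, 3, 1:] t"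
    using assms by (simp add: power2_eq_square del: poly_pCons poly_mult) (intro poly_pCons_mono order_refl; simp)
  then show ?thesis unfolding h s .
qed

lemma P4_poly_3_le:
  assumes "0 \<le> t"
  shows "P4_poly 3 t \<le> spec_prod {#14143/10000, 19022/10000, 11756/10000#} t"
proof -
  have h: "P4_poly 3 t = poly [:1, 7, 15, 10:] t"
    by (simp add: P4_poly_def path_poly_values algebra_simps numeral_eq_Suc)
  have s: "poly ([:1, (14143/10000)\<^sup>2:] * [:1, (19022/10000)\<^sup>2:] * [:1, (11756/10000)\<^sup>2:]) t = spec_prod {#14143/10000, 19022/10000, 11756/10000#} t"
    by (simp only: poly_mult poly_pCons poly_0 spec_prod_simps mult_zero_right add_0_right mult_1_right mult.assoc mult.commute[of t])
  have "poly [:1, 7, 15, 10:] t \<le> poly ([:1, (14143/10000)\<^sup>2:] * [:1, (19022/10000)\<^sup>2:] * [:1, (11756/10000)\<^sup>2:]) t"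
    using assms by (simp add: power2_eq_square del: poly_pCons poly_mult) (intro poly_pCons_mono order_refl; simp)
  then show ?thesis unfolding h s .
qed

lemma path_poly_6_ge:
  assumes "0 \<le> t"
  shows "spec_prod {#4450/10000, 12469/10000, 18019/10000#} t \<le> path_poly 6 t"
proof -
  have h: "path_poly 6 t = poly [:1, 5, 6, 1:] t"
    by (simp add: P4_poly_def path_poly_values algebra_simps numeral_eq_Suc)
  have s: "poly ([:1, (4450/10000)\<^sup>2:] * [:1, (12469/10000)\<^sup>2:] * [:1, (18019/10000)\<^sup>2:]) t = spec_prod {#4450/10000, 12469/10000, 18019/10000#} t"
    by (simp only: poly_mult poly_pCons poly_0 spec_prod_simps mult_zero_right add_0_right mult_1_right mult.assoc mult.commute[of t])
  have "poly ([:1, (4450/10000)\<^sup>2:] * [:1, (12469/10000)\<^sup>2:] * [:1, (18019/10000)\<^sup>2:]) t \<le> poly [:1, 5, 6, 1:] t"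
    using assms by (simp add: power2_eq_square del: poly_pCons poly_mult) (intro poly_pCons_mono order_refl; simp)
  then show ?thesis unfolding h s .
qed

lemma P4_poly_5_ge:
  assumes "0 \<le> t"
  shows "spec_prod {#141/100, 1949/1000, 1563/1000, 867/1000#} t \<le> P4_poly 5 t"
proof -
  have h: "P4_poly 5 t = poly [:1, 9, 28, 35, 14:] t"
    by (simp add: P4_poly_def path_poly_values algebra_simps numeral_eq_Suc)
  have s: "poly ([:1, (141/100)\<^sup>2:] * [:1, (1949/1000)\<^sup>2:] * [:1, (1563/1000)\<^sup>2:] * [:1, (867/1000)\<^sup>2:]) t = spec_prod {#141/100, 1949/1000, 1563/1000, 867/1000#} t"
    by (simp only: poly_mult poly_pCons poly_0 spec_prod_simps mult_zero_right add_0_right mult_1_right mult.assoc mult.commute[of t])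
  have "poly ([:1, (141/100)\<^sup>2:] * [:1, (1949/1000)\<^sup>2:] * [:1, (1563/1000)\<^sup>2:] * [:1, (867/1000)\<^sup>2:]) t \<le> poly [:1, 9, 28, 35, 14:] t"
    using assms by (simp add: power2_eq_square del: poly_pCons poly_mult) (intro poly_pCons_mono order_refl; simp)
  then show ?thesis unfolding h s .
qed

section \<open>Comparing the energies\<close>

text \<open>
  Multiplying by \<open>spec_prod A\<close> and \<open>spec_prod B\<close> adds \<open>A\<close> and \<open>B\<close> to the spectra, hence
  \<open>\<Sum>A\<close> and \<open>\<Sum>B\<close> to the energies.  This allows comparisons in which \<open>char_sq G \<sigma>\<close> is larger than
  \<open>char_sq H \<tau>\<close> for some \<open>x\<close>.
\<close>

lemma energy_le_if_char_sq_le: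
  assumes G: "signed_graph G \<sigma>" and H: "signed_graph H \<tau>"
    and le: "\<And>x. 0 < x \<Longrightarrow>
      char_sq G \<sigma> x * spec_prod A (x\<^sup>2) \<le> char_sq H \<tau> x * spec_prod B (x\<^sup>2)"
    and sum: "(\<Sum>b\<in>#B. \<bar>b\<bar>) \<le> (\<Sum>a\<in>#A. \<bar>a\<bar>)"
  shows "energy G \<sigma> \<le> energy H \<tau>"
proof -
  obtain K where K: "energy G \<sigma> = (\<Sum>a\<in>#K. \<bar>a\<bar>)"
    "\<And>x. x > 0 \<Longrightarrow> char_sq G \<sigma> x = spec_prod K (x\<^sup>2)"
    using energy_spectrum[OF G] unfolding char_sq_def spec_prod_def by metis
  obtain L where L: "energy H \<tau> = (\<Sum>a\<in>#L. \<bar>a\<bar>)"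
    "\<And>x. x > 0 \<Longrightarrow> char_sq H \<tau> x = spec_prod L (x\<^sup>2)"
    using energy_spectrum[OF H] unfolding char_sq_def spec_prod_def by metis
  have "(\<Sum>a\<in>#K + A. \<bar>a\<bar>) \<le> (\<Sum>a\<in>#L + B. \<bar>a\<bar>)"
  proof (rule sum_abs_le_if_prod_le)
    fix x :: real assume "x > 0"
    then have "spec_prod (K + A) (x\<^sup>2) \<le> spec_prod (L + B) (x\<^sup>2)"
      using le[of x] K(2) L(2) by simp
    then show "(\<Prod>a\<in>#K + A. 1 + a\<^sup>2 * x\<^sup>2) \<le> (\<Prod>a\<in>#L + B. 1 + a\<^sup>2 * x\<^sup>2)"
      unfolding spec_prod_def .
  qed
  then show ?thesis using sum by (simp add: K(1) L(1))
qed

lemma P4_poly_nonneg: "0 \<le> t \<Longrightarrow> 0 \<le> P4_poly j t"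
  by (simp add: P4_poly_def path_poly_nonneg)

lemma char_sq_nonneg: "0 \<le> char_sq G \<sigma> x"
  by (simp add: char_sq_def)

lemma spec_prod_nonneg: "0 \<le> t \<Longrightarrow> 0 \<le> spec_prod L t"
  by (induction L) simp_all

theorem theorem3p12:
  fixes n :: nat and G :: "'a pair_pre_digraph" and \<sigma> :: "'a set \<Rightarrow> int"
  assumes "n \<ge> 4"
    and "signed_graph G \<sigma>"
    and "connected_unicyclic G"
    and "card (pverts G) = n"
  shows "(n \<in> {5, 7} \<longrightarrow> energy G \<sigma> \<le> energy (cycle_graph n) cycle_pos_sign) \<and>
         (n \<notin> {5, 7} \<longrightarrow> energy G \<sigma> \<le> energy (P4_graph n) P4_sign)"
proof -
  obtain l m where l: "3 \<le> l" and lm: "l + m = n"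
    and ev: "\<And>x. 0 < x \<Longrightarrow> even l \<Longrightarrow>
       char_sq G \<sigma> x \<le> (tadpole_poly l m (x\<^sup>2) + 2 * (x\<^sup>2) ^ (l div 2) * path_poly m (x\<^sup>2))\<^sup>2"
    and od: "\<And>x. 0 < x \<Longrightarrow> odd l \<Longrightarrow>
       char_sq G \<sigma> x \<le> (tadpole_poly l m (x\<^sup>2))\<^sup>2 + 4 * (x\<^sup>2) ^ l * (path_poly m (x\<^sup>2))\<^sup>2"
    using unicyclic_char_sq_le[OF assms(2-4)] by blast
  obtain j where n: "n = 4 + j" using assms(1) le_Suc_ex by blast
  have H: "signed_graph (P4_graph n) P4_sign" using signed_graph_P4_graph[OF assms(1)] .
  have C: "signed_graph (cycle_graph n) cycle_pos_sign" using signed_graph_cycle_graph assms(1) by simp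
  have even_le: "char_sq G \<sigma> x \<le> (P4_poly j (x\<^sup>2))\<^sup>2" if "even l" "0 < x" for x
  proof -
    have "l \<ge> 4" using l that(1) by (cases "l = 3") auto
    then have "tadpole_poly l m (x\<^sup>2) + 2 * (x\<^sup>2) ^ (l div 2) * path_poly m (x\<^sup>2) \<le> P4_poly j (x\<^sup>2)"
      using that lm n by (intro even_tadpole_le) auto
    moreover have "0 \<le> tadpole_poly l m (x\<^sup>2) + 2 * (x\<^sup>2) ^ (l div 2) * path_poly m (x\<^sup>2)"
      using tadpole_poly_ge_1[of "x\<^sup>2" l m] path_poly_nonneg[of "x\<^sup>2" m] by simp
    ultimately have "(tadpole_poly l m (x\<^sup>2) + 2 * (x\<^sup>2) ^ (l div 2) * path_poly m (x\<^sup>2))\<^sup>2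
        \<le> (P4_poly j (x\<^sup>2))\<^sup>2" by (rule power_mono)
    then show ?thesis using ev[OF that(2,1)] by linarith
  qed
  have small: "energy G \<sigma> \<le> energy (cycle_graph n) cycle_pos_sign" if n57: "n \<in> {5, 7}"
  proof -
    have on: "odd n" "3 \<le> n" using n57 by auto
    note cyc = char_sq_odd_cycle[OF on]
    show ?thesis
    proof (cases "even l")
      case False
      show ?thesis
      proof (rule energy_le_if_char_sq_le[OF assms(2) C, where A = "{#}" and B = "{#}"])
        fix x :: real assume "0 < x"
        then show "char_sq G \<sigma> x * spec_prod {#} (x\<^sup>2)
            \<le> char_sq (cycle_graph n) cycle_pos_sign x * spec_prod {#} (x\<^sup>2)"
          using od[of x] False odd_tadpole_le_cycle_5_7[of "x\<^sup>2" l m n] l lm n57 by (simp add: cyc)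
      qed simp
    next
      case True
      \<comment> \<open>The eigenvalue 2 of the odd cycle is simple and belongs to the factor \<open>1 +
        4t\<close>; all other factors on both sides occur twice.\<close>
      have cmp: "energy G \<sigma> \<le> energy (cycle_graph n) cycle_pos_sign"
        if S: "\<And>t. 0 \<le> t \<Longrightarrow> P4_poly j t \<le> spec_prod K t"
          and P: "\<And>t. 0 \<le> t \<Longrightarrow> spec_prod L t \<le> path_poly (n - 1) t"
          and sum: "(\<Sum>a\<in>#K. \<bar>a\<bar>) \<le> 1 + (\<Sum>a\<in>#L. \<bar>a\<bar>)" for K L
      proof (rule energy_le_if_char_sq_le[OF assms(2) C, where A = "add_mset 2 (L + L)" and B = "K + K"])
        fix x :: real assume x: "0 < x"
        let ?t = "x\<^sup>2"
        have "char_sq G \<sigma> x \<le> (spec_prod K ?t)\<^sup>2"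
          using even_le[OF True x] power_mono[OF S[of ?t] P4_poly_nonneg, of 2] by simp
        moreover have "(1 + 4 * ?t) * (spec_prod L ?t)\<^sup>2 \<le> char_sq (cycle_graph n) cycle_pos_sign x"
          unfolding cyc using P[of ?t] spec_prod_nonneg[of ?t]
          by (intro mult_left_mono power_mono) auto
        ultimately have "char_sq G \<sigma> x * ((1 + 4 * ?t) * (spec_prod L ?t)\<^sup>2)
            \<le> (spec_prod K ?t)\<^sup>2 * char_sq (cycle_graph n) cycle_pos_sign x"
          by (intro mult_mono) auto
        then show "char_sq G \<sigma> x * spec_prod (add_mset 2 (L + L)) ?t
           \<le> char_sq (cycle_graph n) cycle_pos_sign x * spec_prod (K + K) ?t"
          by (simp add: power2_eq_square mult.commute)
      next
        show "(\<Sum>a\<in>#K + K. \<bar>a\<bar>) \<le> (\<Sum>a\<in>#add_mset 2 (L + L). \<bar>a\<bar>)"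
          using sum by (simp only: image_mset_union sum_mset.union image_mset_add_mset sum_mset.add_mset)
      qed
      from n57 consider "n - 1 = 4" "j = 1" | "n - 1 = 6" "j = 3" using n by auto
      then show ?thesis
      proof cases
        case 1
        show ?thesis
          by (rule cmp[of "{#142/100, 174/100#}" "{#16/10, 6/10#}"])
            (use P4_poly_1_le path_poly_4_ge in \<open>simp_all only: 1\<close>, simp)
      next
        case 2
        show ?thesis
          by (rule cmp[of "{#14143/10000, 19022/10000, 11756/10000#}" "{#4450/10000, 12469/10000, 18019/10000#}"])
            (use P4_poly_3_le path_poly_6_ge in \<open>simp_all only: 2\<close>, simp)
      qed
    qed
  qed
  have large: "energy G \<sigma> \<le> energy (P4_graph n) P4_sign" if n57: "n \<notin> {5, 7}"
  proof -
    have P4: "char_sq (P4_graph n) P4_sign x = (P4_poly j (x\<^sup>2))\<^sup>2" for x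
      unfolding n by (rule char_sq_P4)
    have pointwise: "energy G \<sigma> \<le> energy (P4_graph n) P4_sign"
      if "\<And>x. 0 < x \<Longrightarrow> char_sq G \<sigma> x \<le> (P4_poly j (x\<^sup>2))\<^sup>2"
      using that by (intro energy_le_if_char_sq_le[OF assms(2) H, where A = "{#}" and B = "{#}"]) (simp_all add: P4)
    consider "even l" | "odd l" "even n" | "odd l" "odd n" by blast
    then show ?thesis
    proof cases
      case 1
      then show ?thesis by (intro pointwise even_le)
    next
      case 2
      show ?thesis
      proof (rule pointwise)
        fix x :: real assume x: "0 < x"
        have "m \<ge> 1" using 2 lm by (cases "m = 0") auto
        then have "char_sq G \<sigma> x \<le> odd_majorant j (x\<^sup>2)"
          using od[OF x 2(1)] odd_tadpole_le_majorant[of "x\<^sup>2" l m j] 2(1) l lm n by simp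
        also have "\<dots> \<le> (P4_poly j (x\<^sup>2))\<^sup>2"
          using 2 n by (intro odd_majorant_le_even_order) auto
        finally show "char_sq G \<sigma> x \<le> (P4_poly j (x\<^sup>2))\<^sup>2" .
      qed
    next
      case 3
      have j: "j \<ge> 5"
      proof -
        have "odd j" "j \<noteq> 1" "j \<noteq> 3" using 3 n n57 by auto
        then show ?thesis by presburger
      qed
      \<comment> \<open>Lower bounds for the positive eigenvalues of the 4-cycle tadpole of order nine. Each
        of them is an eigenvalue together with its negative, hence the doubled list below.\<close>
      let ?A = "{#141/100, 1949/1000, 1563/1000, 867/1000 :: real#}"
      \<comment> \<open>A comparison with order nine suffices, where \<open>B\<close> approximates the
        spectrum of the competitor from above.\<close>
      have cmp: "energy G \<sigma> \<le> energy (P4_graph n) P4_sign"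
        if B: "\<And>x. 0 < x \<Longrightarrow> char_sq G \<sigma> x * (P4_poly 5 (x\<^sup>2))\<^sup>2
            \<le> (P4_poly j (x\<^sup>2))\<^sup>2 * spec_prod B (x\<^sup>2)"
          and sum: "(\<Sum>b\<in>#B. \<bar>b\<bar>) \<le> (\<Sum>a\<in>#?A + ?A. \<bar>a\<bar>)" for B
      proof (rule energy_le_if_char_sq_le[OF assms(2) H _ sum])
        fix x :: real assume x: "0 < x"
        have "(spec_prod ?A (x\<^sup>2))\<^sup>2 \<le> (P4_poly 5 (x\<^sup>2))\<^sup>2"
          using P4_poly_5_ge spec_prod_nonneg by (intro power_mono) auto
        then have "char_sq G \<sigma> x * (spec_prod ?A (x\<^sup>2))\<^sup>2 \<le> char_sq G \<sigma> x * (P4_poly 5 (x\<^sup>2))\<^sup>2"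
          by (intro mult_left_mono char_sq_nonneg)
        also note B[OF x]
        finally show "char_sq G \<sigma> x * spec_prod (?A + ?A) (x\<^sup>2)
            \<le> char_sq (P4_graph n) P4_sign x * spec_prod B (x\<^sup>2)"
          unfolding P4 by (simp only: spec_prod_simps(3) power2_eq_square)
      qed
      show ?thesis
      proof (cases "m = 0")
        case False
        show ?thesis
        proof (rule cmp)
          fix x :: real assume x: "0 < x"
          have "char_sq G \<sigma> x \<le> odd_majorant j (x\<^sup>2)"
            using od[OF x 3(1)] odd_tadpole_le_majorant[of "x\<^sup>2" l m j] 3(1) l lm n False by simp
          then have "char_sq G \<sigma> x * (P4_poly 5 (x\<^sup>2))\<^sup>2 \<le> odd_majorant j (x\<^sup>2) * (P4_poly 5 (x\<^sup>2))\<^sup>2"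
            by (rule mult_right_mono) simp
          also have "\<dots> \<le> (P4_poly j (x\<^sup>2))\<^sup>2 * odd_majorant 5 (x\<^sup>2)"
            by (rule odd_majorant_ratio_le[OF _ j]) simp
          also have "\<dots> \<le> (P4_poly j (x\<^sup>2))\<^sup>2
              * spec_prod {#4/20, 13/20, 22/20, 23/20, 25/20, 29/20, 30/20, 39/20, 46/20#} (x\<^sup>2)"
            by (intro mult_left_mono odd_majorant_5_le) auto
          finally show "char_sq G \<sigma> x * (P4_poly 5 (x\<^sup>2))\<^sup>2 \<le> (P4_poly j (x\<^sup>2))\<^sup>2
              * spec_prod {#4/20, 13/20, 22/20, 23/20, 25/20, 29/20, 30/20, 39/20, 46/20#} (x\<^sup>2)" .
        qed simp
      next
        case True
        show ?thesis
        proof (rule cmp)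
          fix x :: real assume x: "0 < x"
          let ?t = "x\<^sup>2"
          have ln: "l = n" "l - 1 = j + 3" using True lm n by auto
          have "char_sq G \<sigma> x \<le> (1 + 4 * ?t) * (path_poly (j + 3) ?t)\<^sup>2"
            using od[OF x 3(1)] odd_cycle_poly[OF 3(1) l, of ?t] True ln by simp
          then have "char_sq G \<sigma> x * (P4_poly 5 ?t)\<^sup>2
             \<le> (1 + 4 * ?t) * (path_poly (j + 3) ?t)\<^sup>2 * (P4_poly 5 ?t)\<^sup>2"
            by (rule mult_right_mono) simp
          also have "\<dots> = (1 + 4 * ?t) * (path_poly (j + 3) ?t * P4_poly 5 ?t)\<^sup>2"
            by (simp add: power_mult_distrib)
          also have "\<dots> \<le> (1 + 4 * ?t) * (P4_poly j ?t * path_poly 8 ?t)\<^sup>2"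
            using odd_cycle_ratio_le[OF _ j, of ?t] path_poly_nonneg[of ?t] P4_poly_nonneg[of ?t]
            by (intro mult_left_mono power_mono) auto
          also have "\<dots> = (P4_poly j ?t)\<^sup>2 * ((1 + 4 * ?t) * (path_poly 8 ?t)\<^sup>2)"
            by (simp add: power_mult_distrib)
          also have "\<dots> \<le> (P4_poly j ?t)\<^sup>2
              * spec_prod {#2, 35/100, 35/100, 1, 1, 154/100, 154/100, 188/100, 188/100#} ?t"
            by (intro mult_left_mono odd_cycle_9_le) auto
          finally show "char_sq G \<sigma> x * (P4_poly 5 ?t)\<^sup>2 \<le> (P4_poly j ?t)\<^sup>2
              * spec_prod {#2, 35/100, 35/100, 1, 1, 154/100, 154/100, 188/100, 188/100#} ?t" .
        qed simp
      qed
    qed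
  qed
  show ?thesis using small large by blast
qed

end
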